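(* Let $\tau\in\mathbb{C}$ with $\operatorname{Im}\tau>0$, and let $p\in E_\tau\setminus E_\tau[2]$ satisfy $\wp'(2p)\neq0$. For $k=1,2$, the Hill discriminant $\Delta_k(A)$ of the generalized Lamé equation is holomorphic for $A\in\mathbb{C}\setminus\{0\}$ but has an essential singularity at $A=0$.
   Context: $\Lambda_\tau=\mathbb{Z}+\mathbb{Z}\tau$, $E_\tau=\mathbb{C}/\Lambda_\tau$, $E_\tau[2]$ is the image of $\{0,\frac12,\frac\tau2,\frac{1+\tau}2\}$; $\wp,\zeta$ are the Weierstrass functions of $\Lambda_\tau$ ($\zeta$ odd, $\zeta'=-\wp$). For $A\in\mathbb{C}\setminus\{0\}$ the generalized Lamé equation is $$y''(z)=\left[2(\wp(z+p)+\wp(z-p))+A(\zeta(z+p)-\zeta(z-p))+B\right]y(z),\qquad B=\frac{A^2}{4}-A\zeta(2p)-\frac{2\wp'(2p)}{A}-\wp(2p).$$ For this $B$ all solutions are single-valued meromorphic functions on $\mathbb{C}$, so for a basis $(\tilde y_1,\tilde y_2)$ of solutions there are $N_1(A),N_2(A)\in SL(2,\mathbb{C})$ with $(\tilde y_1,\tilde y_2)^T(z+1)=N_1(A)(\tilde y_1,\tilde y_2)^T(z)$ and $(\tilde y_1,\tilde y_2)^T(z+\tau)=N_2(A)(\tilde y_1,\tilde y_2)^T(z)$. The Hill discriminants are $\Delta_k(A)=\frac12\operatorname{tr}N_k(A)$, $k=1,2$, which do not depend on the basis. *)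

theory Defs
  imports "HOL-Complex_Analysis.Complex_Analysis"
begin

definition lattice :: "complex \<Rightarrow> complex set" where
  "lattice \<tau> = {of_int m + of_int n * \<tau> | m n :: int. True}"

text \<open>
  The torus is the quotient \<open>UNIV // torus_rel \<tau>\<close>. Its points are given by representatives
  in the plane; the equation below depends only on the class of \<open>p\<close>, since the
  quasi-periods of the zeta function cancel between the potential and \<open>lame_B\<close>.
\<close>

definition torus_rel :: "complex \<Rightarrow> (complex \<times> complex) set" where
  "torus_rel \<tau> = {(z, w). z - w \<in> lattice \<tau>}"

definition torus_class :: "complex \<Rightarrow> complex \<Rightarrow> complex set" where
  "torus_class \<tau> z = torus_rel \<tau> `` {z}"

definition torus_two_torsion :: "complex \<Rightarrow> complex set set" where
  "torus_two_torsion \<tau> = torus_class \<tau> ` {0, 1/2, \<tau>/2, (1 + \<tau>)/2}"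

definition weierstrass_wp :: "complex \<Rightarrow> complex \<Rightarrow> complex" where
  "weierstrass_wp \<tau> z = 1 / z^2 + (\<Sum>\<^sub>\<infinity>w\<in>lattice \<tau> - {0}. 1 / (z - w)^2 - 1 / w^2)"

definition weierstrass_zeta :: "complex \<Rightarrow> complex \<Rightarrow> complex" where
  "weierstrass_zeta \<tau> z = 1 / z + (\<Sum>\<^sub>\<infinity>w\<in>lattice \<tau> - {0}. 1 / (z - w) + 1 / w + z / w^2)"

definition lame_B :: "complex \<Rightarrow> complex \<Rightarrow> complex \<Rightarrow> complex" where
  "lame_B \<tau> p A = A^2 / 4 - A * weierstrass_zeta \<tau> (2*p)
     - 2 * deriv (weierstrass_wp \<tau>) (2*p) / A - weierstrass_wp \<tau> (2*p)"

definition lame_potential :: "complex \<Rightarrow> complex \<Rightarrow> complex \<Rightarrow> complex \<Rightarrow> complex" where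
  "lame_potential \<tau> p A z =
     2 * (weierstrass_wp \<tau> (z + p) + weierstrass_wp \<tau> (z - p))
     + A * (weierstrass_zeta \<tau> (z + p) - weierstrass_zeta \<tau> (z - p)) + lame_B \<tau> p A"

definition lame_singular :: "complex \<Rightarrow> complex \<Rightarrow> complex set" where
  "lame_singular \<tau> p = {z. z + p \<in> lattice \<tau> \<or> z - p \<in> lattice \<tau>}"

text \<open>
  A solution is a function meromorphic on the whole plane. Its values at the singular points
  of the equation carry no information, so every identity between solutions is required only
  outside \<open>lame_singular \<tau> p\<close>.
\<close>

definition lame_solution ::
    "complex \<Rightarrow> complex \<Rightarrow> complex \<Rightarrow> (complex \<Rightarrow> complex) \<Rightarrow> bool" where
  "lame_solution \<tau> p A y \<longleftrightarrow>
     y meromorphic_on UNIV \<and> y holomorphic_on (- lame_singular \<tau> p) \<and>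
     (\<forall>z. z \<notin> lame_singular \<tau> p \<longrightarrow> deriv (deriv y) z = lame_potential \<tau> p A z * y z)"

definition lame_basis ::
    "complex \<Rightarrow> complex \<Rightarrow> complex \<Rightarrow> (complex \<Rightarrow> complex) \<Rightarrow> (complex \<Rightarrow> complex) \<Rightarrow> bool" where
  "lame_basis \<tau> p A y1 y2 \<longleftrightarrow>
     lame_solution \<tau> p A y1 \<and> lame_solution \<tau> p A y2 \<and>
     (\<forall>a b. (\<forall>z. z \<notin> lame_singular \<tau> p \<longrightarrow> a * y1 z + b * y2 z = 0) \<longrightarrow> a = 0 \<and> b = 0) \<and>
     (\<forall>y. lame_solution \<tau> p A y \<longrightarrow>
        (\<exists>a b. \<forall>z. z \<notin> lame_singular \<tau> p \<longrightarrow> y z = a * y1 z + b * y2 z))"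

definition lame_monodromy ::
    "complex \<Rightarrow> complex \<Rightarrow> complex \<Rightarrow> (complex \<Rightarrow> complex) \<Rightarrow> (complex \<Rightarrow> complex) \<Rightarrow>
     complex^2^2 \<Rightarrow> bool" where
  "lame_monodromy \<tau> p \<omega> y1 y2 N \<longleftrightarrow>
     det N = 1 \<and>
     (\<forall>z. z \<notin> lame_singular \<tau> p \<longrightarrow>
        (vector [y1 (z + \<omega>), y2 (z + \<omega>)] :: complex^2) = N *v vector [y1 z, y2 z])"

definition period :: "complex \<Rightarrow> nat \<Rightarrow> complex" where
  "period \<tau> k = (if k = 1 then 1 else \<tau>)"

text \<open>
  Meaningful for \<open>k = 1, 2\<close> and nonzero \<open>A\<close>. The use of \<open>THE\<close> rests on the existence of a
  basis and on the independence of the trace from its choice.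
\<close>

definition hill_discriminant :: "complex \<Rightarrow> complex \<Rightarrow> nat \<Rightarrow> complex \<Rightarrow> complex" where
  "hill_discriminant \<tau> p k A =
     (THE d. \<exists>y1 y2 N. lame_basis \<tau> p A y1 y2 \<and>
        lame_monodromy \<tau> p (period \<tau> k) y1 y2 N \<and> d = trace N / 2)"

end

theory Submission
  imports Defs
begin

text \<open>
  The singular points of the equation have exponents \<open>-1\<close> and \<open>2\<close>, and the value of \<open>B\<close> is the
  one that removes the logarithms. A gauge transformation then makes the equation regular near
  each singular point, so that it is solvable on small discs; by uniqueness the local solutions
  glue to meromorphic solutions on the plane. Hence the discriminant is
  \<open>(Y\<^sub>1(z\<^sub>0 + \<omega>) + Y\<^sub>2'(z\<^sub>0 + \<omega>)) / 2\<close> for the solutions normalized at a point \<open>z\<^sub>0\<close>, and it can be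
  computed in a strip around a segment from \<open>z\<^sub>0\<close> to \<open>z\<^sub>0 + \<omega>\<close> that avoids the singular points. There
  the Picard iteration converges locally uniformly in \<open>A\<close>, which gives holomorphy for nonzero \<open>A\<close>.

  For \<open>A \<rightarrow> 0\<close> the potential is dominated by the constant \<open>-2\<wp>'(2p)/A\<close>. Along
  \<open>A = -2\<wp>'(2p)\<omega>\<^sup>2/n\<^sup>2\<close> the equation on the segment is \<open>y'' = (n\<^sup>2 + O(1)) y\<close>, so the discriminant
  grows like \<open>e\<^sup>n\<close>, faster than any power of \<open>1/A\<close>: the singularity is neither removable nor a pole.
\<close>

section \<open>Linear systems with holomorphic parameters\<close>

text \<open>The discriminant is defined through bases of meromorphic solutions on the whole plane,
  so a computation on a segment says something about it only once global solutions are known to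
  exist for every nonzero \<open>A\<close>. Instead of the monodromy theorem, solutions are glued
  over overlapping rectangles, for which discs of one fixed radius are enough; periodicity and
  evenness of the potential carry such a radius from the single point \<open>p\<close> to all
  singular points. Since the singular set does not depend on \<open>A\<close>, one segment serves
  all parameters. The special values of \<open>A\<close> come from rescaling. With
  \<open>z = z0 + t * \<omega>\<close> the potential is multiplied by \<open>\<omega>^2\<close>, and
  \<open>A\<close> is chosen so that the polar term becomes exactly the positive real number
  \<open>n^2\<close>. The rest stays bounded, and the error in the trace is a fixed fraction of
  \<open>e^n\<close>, so a crude estimate suffices. The condition on \<open>wp'(2p)\<close> is what
  makes the constant term of the potential unbounded as \<open>A\<close> tends to
  \<open>0\<close>.\<close>

text \<open>
  Finite sums of products \<open>h z * k A\<close>. Integrating in \<open>z\<close> stays within this class, so the Picard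
  iterates are holomorphic in \<open>A\<close> without differentiation under the integral sign.
\<close>

inductive separated :: "complex set \<Rightarrow> complex set \<Rightarrow> (complex \<Rightarrow> complex \<Rightarrow> complex) \<Rightarrow> bool"
  for U V where
  tensor: "h holomorphic_on U \<Longrightarrow> k holomorphic_on V \<Longrightarrow> separated U V (\<lambda>z A. h z * k A)"
| add: "separated U V F \<Longrightarrow> separated U V G \<Longrightarrow> separated U V (\<lambda>z A. F z A + G z A)"

lemma separated_left: "h holomorphic_on U \<Longrightarrow> separated U V (\<lambda>z A. h z)"
  using separated.tensor[of h U "\<lambda>_. 1" V] by simp

lemma separated_right: "k holomorphic_on V \<Longrightarrow> separated U V (\<lambda>z A. k A)"
  using separated.tensor[of "\<lambda>_. 1" U k V] by simp

lemma separated_mult: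
  assumes "separated U V F" "separated U V G"
  shows "separated U V (\<lambda>z A. F z A * G z A)"
  using assms(1)
proof induction
  case (tensor h k)
  from assms(2) show ?case
  proof induction
    case (tensor h' k')
    have "separated U V (\<lambda>z A. (h z * h' z) * (k A * k' A))"
      using tensor \<open>h holomorphic_on U\<close> \<open>k holomorphic_on V\<close>
      by (intro separated.tensor holomorphic_on_mult)
    then show ?case by (simp add: mult_ac)
  next
    case (add F G)
    from separated.add[OF add.IH] show ?case by (simp add: distrib_left)
  qed
next
  case (add F G)
  from separated.add[OF add.IH] show ?case by (simp add: distrib_right)
qed

lemma separated_holomorphic_right:
  "separated U V F \<Longrightarrow> z \<in> U \<Longrightarrow> (\<lambda>A. F z A) holomorphic_on V"
  by (induction rule: separated.induct) (auto intro!: holomorphic_intros)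

text \<open>Only the \<open>z\<close> factor is integrated and the \<open>A\<close> factor is
  carried along. With the primitive normalized at \<open>z0\<close>, later Picard terms leave the
  initial value alone.\<close>

lemma separated_primitive:
  assumes "open U" "convex U" "separated U V F"
  shows "\<exists>G. separated U V G \<and> (\<forall>A. G z0 A = 0) \<and>
    (\<forall>z\<in>U. \<forall>A. ((\<lambda>z. G z A) has_field_derivative F z A) (at z))"
  using assms(3)
proof induction
  case (tensor h k)
  obtain g where g: "\<And>x. x \<in> U \<Longrightarrow> (g has_field_derivative h x) (at x within U)"
    using holomorphic_convex_primitive'[OF _ assms(1) tensor(1)] assms(2)
    by (metis assms(1) holomorphic_convex_primitive' tensor(1))
  then have g': "(g has_field_derivative h x) (at x)" if "x \<in> U" for x
    using that assms(1) by (metis at_within_open)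
  have "g holomorphic_on U"
    using g by (auto simp: holomorphic_on_def field_differentiable_def)
  then have "separated U V (\<lambda>z A. (g z - g z0) * k A)"
    using tensor by (intro separated.tensor holomorphic_intros)
  moreover have "((\<lambda>z. (g z - g z0) * k A) has_field_derivative h z * k A) (at z)"
    if "z \<in> U" for z A
    using g'[OF that] by (auto intro!: derivative_eq_intros)
  ultimately show ?case
    by (intro exI[of _ "\<lambda>z A. (g z - g z0) * k A"]) auto
next
  case (add F G)
  then obtain F' G' where
    "separated U V F'" "\<forall>A. F' z0 A = 0"
    "\<And>z A. z \<in> U \<Longrightarrow> ((\<lambda>z. F' z A) has_field_derivative F z A) (at z)"
    "separated U V G'" "\<forall>A. G' z0 A = 0"
    "\<And>z A. z \<in> U \<Longrightarrow> ((\<lambda>z. G' z A) has_field_derivative G z A) (at z)"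
    by blast
  then show ?case
    by (intro exI[of _ "\<lambda>z A. F' z A + G' z A"])
       (auto intro!: separated.add derivative_eq_intros)
qed

text \<open>Induction step of the Picard estimate. Along the segment from \<open>z0\<close> to
  \<open>z\<close> the function is compared with the claimed bound as a function of the real
  parameter, whose derivative is the assumed bound times the length of the segment.\<close>

lemma norm_le_power_fact_integral:
  fixes g :: "complex \<Rightarrow> complex"
  assumes "convex U" "z0 \<in> U" "z \<in> U" "g z0 = 0" 
    and der: "\<And>w. w \<in> U \<Longrightarrow> (g has_field_derivative h w) (at w)"
    and bnd: "\<And>w. w \<in> U \<Longrightarrow> norm (h w) \<le> C * (M * (C * norm (w - z0)) ^ n / fact n)"
  shows "norm (g z) \<le> M * (C * norm (z - z0)) ^ Suc n / fact (Suc n)"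
proof -
  define r where "r = norm (z - z0)"
  define \<gamma> where "\<gamma> = (\<lambda>t::real. z0 + of_real t * (z - z0))"
  have U: "\<gamma> t \<in> U" if "0 \<le> t" "t \<le> 1" for t
  proof -
    have "\<gamma> t = (1 - t) *\<^sub>R z0 + t *\<^sub>R z"
      by (simp add: \<gamma>_def scaleR_conv_of_real algebra_simps)
    then show ?thesis using assms that by (simp add: convexD)
  qed
  have d: "((\<lambda>t. g (\<gamma> t)) has_vector_derivative (z - z0) * h (\<gamma> t)) (at t)"
    if "0 \<le> t" "t \<le> 1" for t
  proof -
    have "(\<gamma> has_vector_derivative (z - z0)) (at t)"
      unfolding \<gamma>_def by (auto intro!: derivative_eq_intros)
    from field_vector_diff_chain_at[OF this der[OF U[OF that]]]
    show ?thesis by (simp add: o_def)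
  qed
  have cont: "continuous_on {0..1} (\<lambda>t. g (\<gamma> t))"
    by (rule continuous_at_imp_continuous_on)
       (use d has_vector_derivative_continuous in force)
  let ?\<phi> = "\<lambda>t::real. M * (C * r * t) ^ Suc n / fact (Suc n)"
  let ?\<phi>' = "\<lambda>t::real. r * (C * (M * (C * (r * t)) ^ n / fact n))"
  have \<phi>: "(?\<phi> has_vector_derivative ?\<phi>' t) (at t)" for t
  proof -
    have "(?\<phi> has_real_derivative M * (of_nat (Suc n) * (C * r * t) ^ n * (C * r)) / fact (Suc n)) (at t)"
      by (rule derivative_eq_intros refl | simp)+
    also have "M * (of_nat (Suc n) * (C * r * t) ^ n * (C * r)) / fact (Suc n) = ?\<phi>' t"
      by (simp add: divide_simps del: of_nat_Suc)
    finally show ?thesis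
      by (simp add: has_real_derivative_iff_has_vector_derivative)
  qed
  have "norm (g (\<gamma> 1) - g (\<gamma> 0)) \<le> ?\<phi> 1 - ?\<phi> 0"
  proof (rule differentiable_bound_general[OF _ cont _ d \<phi>])
    fix t :: real assume t: "0 < t" "t < 1"
    have "norm (\<gamma> t - z0) = r * t" using t by (simp add: \<gamma>_def r_def norm_mult)
    then have "norm (h (\<gamma> t)) \<le> C * (M * (C * (r * t)) ^ n / fact n)"
      using bnd[OF U[of t]] t by simp
    then show "norm ((z - z0) * h (\<gamma> t)) \<le> ?\<phi>' t"
      unfolding norm_mult r_def by (intro mult_left_mono) auto
  qed (auto intro!: continuous_intros)
  then show ?thesis by (simp add: \<gamma>_def r_def assms mult_ac)
qed

text \<open>The Boolean index encodes a 2 by 2 system with zero diagonal. This shape covers both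
  \<open>y'' = Q y\<close>, with coefficients \<open>1\<close> and \<open>Q\<close>, and the
  regularized system at an apparent singularity.\<close>

lemma linear_system_solution:
  fixes coef :: "bool \<Rightarrow> complex \<Rightarrow> complex \<Rightarrow> complex" and init :: "bool \<Rightarrow> complex"
  assumes U: "open U" "convex U" "bounded U" "z0 \<in> U" and V: "open V"
    and sep: "\<And>b. separated U V (coef b)"
    and bnd: "\<And>b z A. z \<in> U \<Longrightarrow> A \<in> V \<Longrightarrow> norm (coef b z A) \<le> C"
  obtains F where
    "\<And>b A. F b z0 A = init b"
    "\<And>b z A. z \<in> U \<Longrightarrow> A \<in> V \<Longrightarrow>
       ((\<lambda>z. F b z A) has_field_derivative coef b z A * F (\<not> b) z A) (at z)"
    "\<And>b z. z \<in> U \<Longrightarrow> (\<lambda>A. F b z A) holomorphic_on V"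
proof -
  have "\<forall>F. \<exists>G. separated U V F \<longrightarrow> separated U V G \<and> (\<forall>A. G z0 A = 0) \<and>
    (\<forall>z\<in>U. \<forall>A. ((\<lambda>z. G z A) has_field_derivative F z A) (at z))"
    using separated_primitive[OF U(1,2)] by blast
  then obtain J where J: "\<And>F. separated U V F \<Longrightarrow> separated U V (J F)"
    "\<And>F A. separated U V F \<Longrightarrow> J F z0 A = 0"
    "\<And>F z A. separated U V F \<Longrightarrow> z \<in> U \<Longrightarrow> ((\<lambda>z. J F z A) has_field_derivative F z A) (at z)"
    by metis
  \<comment> \<open>The increments of the Picard iteration, that is, n-fold iterated integrals; the
    solution \<open>F\<close> is their sum.\<close>
  define X where "X = rec_nat (\<lambda>b z A. init b) (\<lambda>n f b. J (\<lambda>z A. coef b z A * f (\<not> b) z A))"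
  have X0: "X 0 b z A = init b" for b z A by (simp add: X_def)
  have XS: "X (Suc n) b = J (\<lambda>z A. coef b z A * X n (\<not> b) z A)" for n b by (simp add: X_def)
  have sepX: "separated U V (X n b)" for n b
  proof (induction n arbitrary: b)
    case 0
    have "X 0 b = (\<lambda>z A. init b)" by (intro ext) (simp add: X0)
    then show ?case by (simp add: separated_left)
  next
    case (Suc n)
    then show ?case unfolding XS by (intro J separated_mult sep)
  qed
  have sepP: "separated U V (\<lambda>z A. coef b z A * X n (\<not> b) z A)" for n b
    by (intro separated_mult sep sepX)
  have Xder: "((\<lambda>z. X (Suc n) b z A) has_field_derivative coef b z A * X n (\<not> b) z A) (at z)"
    if "z \<in> U" for n b z A
    unfolding XS by (rule J(3)[OF sepP that])
  have Xz0: "X (Suc n) b z0 A = 0" for n b A unfolding XS by (rule J(2)[OF sepP])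
  define M where "M = max (norm (init True)) (norm (init False))"
  have M: "M \<ge> 0" "norm (init b) \<le> M" for b by (cases b; auto simp: M_def le_max_iff_disj)+
  obtain D where D: "\<And>z. z \<in> U \<Longrightarrow> norm (z - z0) \<le> D"
    using U(3) bounded_any_center[of U z0] by (auto simp: dist_norm norm_minus_commute)
  have D0: "D \<ge> 0" using D[OF U(4)] by simp
  have XB: "norm (X n b z A) \<le> M * (C * norm (z - z0)) ^ n / fact n"
    if "z \<in> U" "A \<in> V" for n b z A
    using that(1)
  proof (induction n arbitrary: b z)
    case 0
    then show ?case by (simp add: X0 M)
  next
    case (Suc n)
    have C: "C \<ge> 0" using bnd[OF U(4) that(2), of True] norm_ge_zero order_trans by blast
    show ?case
    proof (rule norm_le_power_fact_integral[OF U(2,4) Suc.prems Xz0 Xder])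
      fix w assume w: "w \<in> U"
      show "norm (coef b w A * X n (\<not> b) w A) \<le> C * (M * (C * norm (w - z0)) ^ n / fact n)"
        unfolding norm_mult using Suc.IH[OF w, of "\<not> b"] bnd[OF w that(2), of b] C
        by (intro mult_mono) auto
    qed
  qed
  \<comment> \<open>\<open>C \<ge> 0\<close> can be derived only from some \<open>A\<close> in
    \<open>V\<close>, and \<open>N\<close> is fixed before one is given; hence the absolute
    value.\<close>
  define N where "N n = M * (\<bar>C\<bar> * D) ^ n / fact n" for n
  have XN: "norm (X n b z A) \<le> N n" if "z \<in> U" "A \<in> V" for n b z A
  proof -
    have "C \<ge> 0" using bnd[OF that, of True] norm_ge_zero order_trans by blast
    then have "(C * norm (z - z0)) ^ n \<le> (\<bar>C\<bar> * D) ^ n"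
      using D[OF that(1)] by (intro power_mono mult_mono) auto
    then have "M * (C * norm (z - z0)) ^ n / fact n \<le> N n"
      unfolding N_def using M by (intro divide_right_mono mult_left_mono) auto
    with XB[OF that, of n b] show ?thesis by linarith
  qed
  have "summable (\<lambda>n. M * (inverse (fact n) * (\<bar>C\<bar> * D) ^ n))"
    using summable_exp by (intro summable_mult) auto
  then have sumN: "summable N" by (simp add: N_def[abs_def] field_simps)
  define F where "F b z A = (\<Sum>n. X n b z A)" for b z A
  have XF: "(\<lambda>n. X n b z A) sums F b z A" if "z \<in> U" "A \<in> V" for b z A
    unfolding F_def
    by (intro summable_sums summable_comparison_test[OF _ sumN]) (use XN[OF that] in auto)
  have Fz0: "F b z0 A = init b" for b A
  proof -
    have "X n b z0 A = 0" if "n \<noteq> 0" for n using that Xz0 by (cases n) auto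
    then have "F b z0 A = (\<Sum>n\<in>{0}. X n b z0 A)"
      unfolding F_def by (intro suminf_finite) auto
    then show ?thesis by (simp add: X0)
  qed
  have Fhol: "(\<lambda>A. F b z A) holomorphic_on V" if z: "z \<in> U" for b z
  proof (rule holomorphic_uniform_sequence[OF V])
    show "(\<lambda>A. \<Sum>i<n. X i b z A) holomorphic_on V" for n
      by (intro holomorphic_intros separated_holomorphic_right[OF sepX z])
    fix A assume "A \<in> V"
    then obtain d where d: "d > 0" "cball A d \<subseteq> V" using V open_contains_cball by blast
    have "uniform_limit (cball A d) (\<lambda>n A. \<Sum>i<n. X i b z A) (\<lambda>A. \<Sum>i. X i b z A) sequentially"
      by (rule Weierstrass_m_test[OF _ sumN]) (use XN z d in blast)
    then show "\<exists>d>0. cball A d \<subseteq> V \<and>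
        uniform_limit (cball A d) (\<lambda>n A. \<Sum>i<n. X i b z A) (F b z) sequentially"
      using d by (auto simp: F_def[abs_def])
  qed
  have Fder: "((\<lambda>z. F b z A) has_field_derivative coef b z A * F (\<not> b) z A) (at z)"
    if z: "z \<in> U" and A: "A \<in> V" for b z A
  proof -
    \<comment> \<open>The constant term \<open>X 0\<close> has derivative \<open>0\<close>. This
      shifts the index by one, and the differentiated series becomes \<open>coef b\<close> times the
      series of the other component.\<close>
    define X' where "X' = (\<lambda>n z. case n of 0 \<Rightarrow> 0 | Suc m \<Rightarrow> coef b z A * X m (\<not> b) z A)"
    have X': "((\<lambda>z. X n b z A) has_field_derivative X' n w) (at w)" if "w \<in> U" for n w
      using Xder[OF that] by (cases n) (simp_all add: X'_def X0)
    define N' where "N' = (\<lambda>n. case n of 0 \<Rightarrow> 0 | Suc m \<Rightarrow> \<bar>C\<bar> * N m)"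
    have sumN': "summable N'"
      by (subst summable_Suc_iff[symmetric]) (simp add: N'_def summable_mult sumN)
    have "uniform_limit U (\<lambda>n w. \<Sum>i<n. X' i w) (\<lambda>w. \<Sum>i. X' i w) sequentially"
    proof (rule Weierstrass_m_test[OF _ sumN'])
      fix n w assume w: "w \<in> U"
      show "norm (X' n w) \<le> N' n"
      proof (cases n)
        case (Suc m)
        have "norm (coef b w A) * norm (X m (\<not> b) w A) \<le> \<bar>C\<bar> * N m"
          using bnd[OF w A, of b] XN[OF w A] by (intro mult_mono) auto
        then show ?thesis by (simp add: Suc X'_def N'_def norm_mult)
      qed (simp_all add: X'_def N'_def)
    qed
    moreover have "(\<Sum>i. X' i w) = coef b w A * F (\<not> b) w A" if "w \<in> U" for w
    proof -
      have "(\<lambda>n. X' (Suc n) w) sums (coef b w A * F (\<not> b) w A)"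
        using sums_mult[OF XF[OF that A]] by (simp add: X'_def)
      then show ?thesis
        using sums_Suc_iff[of "\<lambda>n. X' n w" "coef b w A * F (\<not> b) w A"]
        by (simp add: sums_iff X'_def)
    qed
    ultimately have ul: "uniform_limit U (\<lambda>n w. \<Sum>i<n. X' i w) (\<lambda>w. coef b w A * F (\<not> b) w A) sequentially"
      by (simp cong: uniform_limit_cong')
    obtain g where g: "\<And>w. w \<in> U \<Longrightarrow> (\<lambda>n. X n b w A) sums g w"
      "\<And>w. w \<in> U \<Longrightarrow> (g has_field_derivative coef b w A * F (\<not> b) w A) (at w within U)"
      using has_field_derivative_series[OF U(2) _ ul U(4), of "\<lambda>n w. X n b w A"]
        X' XF[OF U(4) A] by (metis has_field_derivative_at_within sums_summable)
    have "(g has_field_derivative coef b z A * F (\<not> b) z A) (at z)"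
      using g(2)[OF z] unfolding at_within_open[OF z U(1)] .
    then show ?thesis
      by (rule has_field_derivative_transform_within_open[OF _ U(1) z])
         (use g(1) XF[OF _ A] sums_unique2 in blast)
  qed
  show thesis
    using Fz0 Fder Fhol by (rule that)
qed

section \<open>Second-order equations with isolated singularities\<close>

text \<open>Form of \<open>lame_solution\<close> localized to \<open>U\<close>, so that solutions on
  discs can be glued; for \<open>U = UNIV\<close> the two agree.\<close>

definition ode_solution ::
    "(complex \<Rightarrow> complex) \<Rightarrow> complex set \<Rightarrow> complex set \<Rightarrow> (complex \<Rightarrow> complex) \<Rightarrow> bool" where
  "ode_solution Q S U y \<longleftrightarrow> y meromorphic_on U \<and> y holomorphic_on (U - S) \<and>
     (\<forall>z\<in>U - S. deriv (deriv y) z = Q z * y z)"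

text \<open>Each solution is single-valued on all of \<open>U\<close> and meromorphic also at the
  points of \<open>S\<close>: this encodes the absence of logarithms and monodromy in
  \<open>U\<close>.\<close>

definition ode_solvable :: "(complex \<Rightarrow> complex) \<Rightarrow> complex set \<Rightarrow> complex set \<Rightarrow> bool" where
  "ode_solvable Q S U \<longleftrightarrow>
     (\<forall>z\<in>U - S. \<forall>a b. \<exists>y. ode_solution Q S U y \<and> y z = a \<and> deriv y z = b)"

text \<open>By Leibniz' rule the equation expresses every derivative at \<open>z0\<close> of order
  at least two through lower ones. So all of them vanish and the identity theorem applies.\<close>

lemma linear_ode_zero:
  assumes W: "open W" "connected W" and hol: "Q holomorphic_on W" "y holomorphic_on W"
    and ode: "\<And>z. z \<in> W \<Longrightarrow> deriv (deriv y) z = Q z * y z"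
    and z0: "z0 \<in> W" "y z0 = 0" "deriv y z0 = 0" and z: "z \<in> W"
  shows "y z = 0"
proof (rule holomorphic_fun_eq_0_on_connected[OF hol(2) W _ z0(1) z])
  fix n show "(deriv ^^ n) y z0 = 0"
  proof (induction n rule: less_induct)
    case (less n)
    consider "n = 0" | "n = 1" | m where "n = Suc (Suc m)"
      by (metis One_nat_def not0_implies_Suc)
    then show ?case
    proof cases
      case (3 m)
      have "(deriv ^^ n) y z0 = (deriv ^^ m) (deriv (deriv y)) z0"
        by (simp add: 3 funpow_swap1)
      also have "\<dots> = (deriv ^^ m) (\<lambda>w. Q w * y w) z0"
      proof (rule higher_deriv_cong_ev)
        show "\<forall>\<^sub>F w in nhds z0. deriv (deriv y) w = Q w * y w"
          using eventually_nhds_in_open[OF W(1) z0(1)] by eventually_elim (rule ode)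
      qed simp
      also have "\<dots> = (\<Sum>i = 0..m. of_nat (m choose i) * (deriv ^^ i) Q z0 * (deriv ^^ (m-i)) y z0)"
        by (rule higher_deriv_mult[OF hol W(1) z0(1)])
      also have "\<dots> = 0" by (intro sum.neutral ballI) (simp add: 3 less.IH)
      finally show ?thesis .
    qed (use z0 in auto)
  qed
qed

lemma ode_solutionD:
  assumes "ode_solution Q S U y" "open (U - S)" "z \<in> U - S"
  shows "(y has_field_derivative deriv y z) (at z)"
    and "(deriv y has_field_derivative Q z * y z) (at z)"
proof -
  have hol: "y holomorphic_on (U - S)" using assms by (simp add: ode_solution_def)
  show "(y has_field_derivative deriv y z) (at z)"
    using holomorphic_derivI[OF hol assms(2,3)] .
  show "(deriv y has_field_derivative Q z * y z) (at z)"
    using holomorphic_derivI[OF holomorphic_deriv[OF hol assms(2)] assms(2,3)] assms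
    by (simp add: ode_solution_def)
qed

text \<open>Interface to first-order systems: \<open>y'\<close> is the second unknown, recovered as
  \<open>deriv y\<close>.\<close>

lemma ode_solutionI:
  assumes "y meromorphic_on U" "open (U - S)"
    and d: "\<And>z. z \<in> U - S \<Longrightarrow> (y has_field_derivative y' z) (at z)"
           "\<And>z. z \<in> U - S \<Longrightarrow> (y' has_field_derivative Q z * y z) (at z)"
  shows "ode_solution Q S U y" and "\<And>z. z \<in> U - S \<Longrightarrow> deriv y z = y' z"
proof -
  show D: "deriv y z = y' z" if "z \<in> U - S" for z
    using d(1)[OF that] by (rule DERIV_imp_deriv)
  have "y holomorphic_on (U - S)"
    using d(1) assms(2) by (auto simp: holomorphic_on_open)
  moreover have "deriv (deriv y) z = Q z * y z" if z: "z \<in> U - S" for z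
  proof -
    have "deriv (deriv y) z = deriv y' z"
      using eventually_nhds_in_open[OF assms(2) z]
      by (intro deriv_cong_ev refl) (auto elim!: eventually_mono simp: D)
    then show ?thesis using d(2)[OF z] by (simp add: DERIV_imp_deriv)
  qed
  ultimately show "ode_solution Q S U y" using assms(1) by (simp add: ode_solution_def)
qed

lemma ode_solution_subset:
  "ode_solution Q S U y \<Longrightarrow> V \<subseteq> U \<Longrightarrow> ode_solution Q S V y"
  unfolding ode_solution_def
  by (auto intro: meromorphic_on_subset elim: holomorphic_on_subset)

lemma ode_solvable_subset:
  "ode_solvable Q S U \<Longrightarrow> V \<subseteq> U \<Longrightarrow> ode_solvable Q S V"
  unfolding ode_solvable_def by (blast intro: ode_solution_subset)

lemma ode_solution_linear:
  assumes "ode_solution Q S U y1" "ode_solution Q S U y2" "open (U - S)"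
  shows "ode_solution Q S U (\<lambda>z. a * y1 z + b * y2 z)"
    and "\<And>z. z \<in> U - S \<Longrightarrow> deriv (\<lambda>z. a * y1 z + b * y2 z) z = a * deriv y1 z + b * deriv y2 z"
proof -
  have m: "(\<lambda>z. a * y1 z + b * y2 z) meromorphic_on U"
    using assms by (auto simp: ode_solution_def intro!: meromorphic_intros)
  have 1: "((\<lambda>z. a * y1 z + b * y2 z) has_field_derivative a * deriv y1 z + b * deriv y2 z) (at z)"
    if "z \<in> U - S" for z
    using ode_solutionD(1)[OF assms(1,3) that] ode_solutionD(1)[OF assms(2,3) that]
    by (auto intro!: derivative_eq_intros)
  have 2: "((\<lambda>z. a * deriv y1 z + b * deriv y2 z) has_field_derivative Q z * (a * y1 z + b * y2 z)) (at z)"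
    if "z \<in> U - S" for z
    using ode_solutionD(2)[OF assms(1,3) that] ode_solutionD(2)[OF assms(2,3) that]
    by (auto intro!: derivative_eq_intros simp: algebra_simps)
  show "ode_solution Q S U (\<lambda>z. a * y1 z + b * y2 z)"
    by (rule ode_solutionI[OF m assms(3) 1 2])
  show "\<And>z. z \<in> U - S \<Longrightarrow> deriv (\<lambda>z. a * y1 z + b * y2 z) z = a * deriv y1 z + b * deriv y2 z"
    by (rule ode_solutionI[OF m assms(3) 1 2])
qed

text \<open>Meant for translations and reflections: the second derivative picks up the factor
  \<open>e\<^sup>2 = 1\<close>.\<close>

lemma ode_solution_compose_affine:
  assumes "ode_solution Q S U y" "open (U - S)" "e\<^sup>2 = 1"
    and "open V" "\<And>z. z \<in> V \<Longrightarrow> e * z + c \<in> U"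
    and S: "open (V - T)" "\<And>z. z \<in> V - T \<Longrightarrow> e * z + c \<notin> S"
    and Q: "\<And>z. z \<in> V - T \<Longrightarrow> Q (e * z + c) = R z"
  shows "ode_solution R T V (\<lambda>z. y (e * z + c))"
    and "\<And>z. z \<in> V - T \<Longrightarrow> deriv (\<lambda>z. y (e * z + c)) z = e * deriv y (e * z + c)"
proof -
  have m: "(\<lambda>z. y (e * z + c)) meromorphic_on V"
  proof (rule meromorphic_on_compose[of y U "\<lambda>z. e * z + c" V])
    show "y meromorphic_on U" using assms by (simp add: ode_solution_def)
    show "(\<lambda>z. e * z + c) analytic_on V" by (intro analytic_intros)
  qed (use assms in auto)
  have mem: "e * z + c \<in> U - S" if "z \<in> V - T" for z using that assms by auto
  have 1: "((\<lambda>z. y (e * z + c)) has_field_derivative e * deriv y (e * z + c)) (at z)"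
    if "z \<in> V - T" for z
  proof -
    have "((\<lambda>z. e * z + c) has_field_derivative e) (at z)" by (auto intro!: derivative_eq_intros)
    from DERIV_chain2[OF ode_solutionD(1)[OF assms(1,2) mem[OF that]] this]
    show ?thesis by (simp add: mult.commute)
  qed
  have 2: "((\<lambda>z. e * deriv y (e * z + c)) has_field_derivative R z * y (e * z + c)) (at z)"
    if "z \<in> V - T" for z
  proof -
    have "((\<lambda>z. e * z + c) has_field_derivative e) (at z)" by (auto intro!: derivative_eq_intros)
    from DERIV_cmult[OF DERIV_chain2[OF ode_solutionD(2)[OF assms(1,2) mem[OF that]] this], of e]
    show ?thesis
      by (rule DERIV_cong) (use Q[OF that] assms(3) in \<open>simp add: power2_eq_square\<close>)
  qed
  show "ode_solution R T V (\<lambda>z. y (e * z + c))"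
    by (rule ode_solutionI[OF m S(1) 1 2])
  show "\<And>z. z \<in> V - T \<Longrightarrow> deriv (\<lambda>z. y (e * z + c)) z = e * deriv y (e * z + c)"
    by (rule ode_solutionI[OF m S(1) 1 2])
qed

section \<open>Uniqueness and gluing of meromorphic solutions\<close>

locale singular_ode =
  fixes Q :: "complex \<Rightarrow> complex" and S :: "complex set"
  assumes discrete: "\<And>z. \<not> z islimpt S" and hol_Q: "Q holomorphic_on - S"
begin

lemma closed_S: "closed S"
  using discrete closed_limpt by blast

lemma open_diff: "open U \<Longrightarrow> open (U - S)"
  using closed_S by blast

lemma countable_S: "countable S"
proof -
  have "S sparse_in UNIV" unfolding sparse_in_def using discrete open_UNIV by blast
  from sparse_imp_countable[OF open_UNIV this] show ?thesis by simp
qed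

lemma connected_diff: "open U \<Longrightarrow> connected U \<Longrightarrow> connected (U - S)"
  by (rule connected_open_diff_countable) (use countable_S in auto)

lemma regular_point: "open U \<Longrightarrow> U \<noteq> {} \<Longrightarrow> U - S \<noteq> {}"
  using discrete interior_limit_point islimpt_subset
  by (metis Diff_eq_empty_iff ex_in_conv interior_open)

lemma eventually_regular: "eventually (\<lambda>w. w \<notin> S) (at z)"
  using discrete[of z] by (simp add: islimpt_iff_eventually)

text \<open>Removing the countable set \<open>S\<close> leaves \<open>U\<close> connected, so
  uniqueness passes around the singular points, where the values are arbitrary.\<close>

lemma unique:
  assumes U: "open U" "connected U" and y: "ode_solution Q S U y1" "ode_solution Q S U y2"
    and z0: "z0 \<in> U - S" "y1 z0 = y2 z0" "deriv y1 z0 = deriv y2 z0" and z: "z \<in> U - S"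
  shows "y1 z = y2 z"
proof -
  note lin = ode_solution_linear[OF y open_diff[OF U(1)], where a = 1 and b = "-1"]
  have "1 * y1 z + (-1) * y2 z = 0"
  proof (rule linear_ode_zero[OF open_diff[OF U(1)] connected_diff[OF U] _ _ _ z0(1) _ _ z])
    show "Q holomorphic_on U - S" using hol_Q by (rule holomorphic_on_subset) auto
  qed (use lin z0 in \<open>auto simp: ode_solution_def\<close>)
  then show ?thesis by simp
qed

text \<open>Solutions assembled by case distinction agree with the given ones only off
  \<open>S\<close>. As \<open>S\<close> is discrete, this affects neither meromorphy nor derivatives
  at regular points.\<close>

lemma cong:
  assumes "open U" "ode_solution Q S U y" "\<And>z. z \<in> U - S \<Longrightarrow> y' z = y z"
  shows "ode_solution Q S U y'" "\<And>z. z \<in> U - S \<Longrightarrow> deriv y' z = deriv y z"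
proof -
  note op = open_diff[OF assms(1)]
  have ev: "eventually (\<lambda>w. y' w = y w) (at z)" if "z \<in> U" for z
    using eventually_regular[of z] eventually_at_in_open'[OF assms(1) that]
    by eventually_elim (use assms(3) in auto)
  have "y meromorphic_on U" using assms by (simp add: ode_solution_def)
  then have m: "y' meromorphic_on U"
    using meromorphic_on_cong[OF ev refl] by simp
  have d: "(y' has_field_derivative deriv y z) (at z)" if "z \<in> U - S" for z
    by (rule has_field_derivative_transform_within_open[OF ode_solutionD(1)[OF assms(2) op that] op that])
       (simp add: assms(3))
  have d2: "(deriv y has_field_derivative Q z * y' z) (at z)" if "z \<in> U - S" for z
    using ode_solutionD(2)[OF assms(2) op that] assms(3)[OF that] by simp
  show "ode_solution Q S U y'" by (rule ode_solutionI[OF m op d d2])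
  show "\<And>z. z \<in> U - S \<Longrightarrow> deriv y' z = deriv y z" by (rule ode_solutionI[OF m op d d2])
qed

lemma solution_Union:
  assumes "\<And>U. U \<in> \<U> \<Longrightarrow> open U" "\<And>U. U \<in> \<U> \<Longrightarrow> ode_solution Q S U y"
  shows "ode_solution Q S (\<Union>\<U>) y"
  unfolding ode_solution_def
proof (intro conjI)
  show "y meromorphic_on \<Union>\<U>"
    using assms unfolding ode_solution_def meromorphic_on_def by blast
  show "y holomorphic_on \<Union>\<U> - S"
    unfolding holomorphic_on_def
  proof
    fix z assume "z \<in> \<Union>\<U> - S"
    then obtain U where "U \<in> \<U>" "z \<in> U - S" by blast
    with assms have "y field_differentiable at z"
      unfolding ode_solution_def by (metis holomorphic_on_imp_differentiable_at open_diff)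
    then show "y field_differentiable at z within \<Union>\<U> - S"
      by (rule field_differentiable_at_within)
  qed
  show "\<forall>z\<in>\<Union>\<U> - S. deriv (deriv y) z = Q z * y z"
    using assms unfolding ode_solution_def by blast
qed

text \<open>A regular point of the overlap transfers Cauchy data from one set to the other;
  connectedness of the overlap makes the two solutions agree on all of it, so no monodromy can
  arise.\<close>

lemma glue:
  assumes U: "open U" "connected U" and V: "open V" "connected V"
    and UV: "connected (U \<inter> V)" "U \<inter> V \<noteq> {}"
    and "ode_solvable Q S U" "ode_solvable Q S V"
  shows "ode_solvable Q S (U \<union> V)"
proof -
  \<comment> \<open>The datum sits in \<open>U\<close> here; the other case follows by exchanging
    the two sets.\<close>
  have *: "\<exists>y. ode_solution Q S (U \<union> V) y \<and> y z = a \<and> deriv y z = b"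
    if U: "open U" "connected U" and V: "open V" "connected V"
      and UV: "connected (U \<inter> V)" "U \<inter> V \<noteq> {}"
      and s: "ode_solvable Q S U" "ode_solvable Q S V" and z: "z \<in> U - S" for U V z a b
  proof -
    obtain y where y: "ode_solution Q S U y" "y z = a" "deriv y z = b"
      using s z unfolding ode_solvable_def by blast
    obtain z1 where z1: "z1 \<in> U \<inter> V - S"
      using regular_point[of "U \<inter> V"] U V UV by blast
    then obtain y1 where y1: "ode_solution Q S V y1" "y1 z1 = y z1" "deriv y1 z1 = deriv y z1"
      using s unfolding ode_solvable_def by blast
    have eq: "y1 w = y w" if "w \<in> U \<inter> V - S" for w
      by (rule unique[OF _ UV(1) _ _ z1 y1(2,3) that])
         (use U V y1 y in \<open>auto intro: ode_solution_subset\<close>)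
    define Y where "Y w = (if w \<in> U then y w else y1 w)" for w
    have YU: "ode_solution Q S U Y" "\<And>w. w \<in> U - S \<Longrightarrow> deriv Y w = deriv y w"
      by (rule cong[OF U(1) y(1)]; simp add: Y_def)+
    have YV: "ode_solution Q S V Y"
      by (rule cong[OF V(1) y1(1)]) (use eq in \<open>auto simp: Y_def\<close>)
    have "ode_solution Q S (\<Union>{U, V}) Y"
      by (rule solution_Union) (use YU YV U V in auto)
    then show ?thesis
      using YU(2)[OF z] y z by (intro exI[of _ Y]) (auto simp: Y_def)
  qed
  show ?thesis
    unfolding ode_solvable_def
  proof (intro ballI allI)
    fix z a b assume "z \<in> U \<union> V - S"
    then show "\<exists>y. ode_solution Q S (U \<union> V) y \<and> y z = a \<and> deriv y z = b"
      using *[OF U V UV assms(7,8), of z a b] *[OF V U _ _ assms(8,7), of z a b] UV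
      by (auto simp: Un_commute Int_commute)
  qed
qed

lemma solvable_incseq:
  fixes U :: "nat \<Rightarrow> complex set"
  assumes U: "\<And>n. open (U n)" "\<And>n. connected (U n)" "mono U"
    and s: "\<And>n. ode_solvable Q S (U n)"
  shows "ode_solvable Q S (\<Union>n. U n)"
  unfolding ode_solvable_def
proof (intro ballI allI)
  fix z a b assume "z \<in> (\<Union>n. U n) - S"
  then obtain m where m: "z \<in> U m - S" by blast
  have z: "z \<in> U (m + n) - S" for n
    using m monoD[OF U(3), of m "m + n"] by auto
  have "\<exists>y. ode_solution Q S (U (m + n)) y \<and> y z = a \<and> deriv y z = b" for n
    using s z unfolding ode_solvable_def by blast
  then obtain y where y: "\<And>n. ode_solution Q S (U (m + n)) (y n)"
    "\<And>n. y n z = a" "\<And>n. deriv (y n) z = b" by metis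
  have eq: "y n w = y k w" if "w \<in> U (m + n) - S" "n \<le> k" for w n k
    using monoD[OF U(3), of "m + n" "m + k"] that
    by (intro unique[OF U(1,2) y(1) ode_solution_subset[OF y(1)] z _ _ that(1)]) (auto simp: y)
  \<comment> \<open>All \<open>y n\<close> share their Cauchy data at \<open>z\<close>, so every
    admissible index gives the same value off \<open>S\<close>; the least one only fixes a
    choice.\<close>
  define Y where "Y w = y (LEAST n. w \<in> U (m + n)) w" for w
  have Y: "Y w = y n w" if "w \<in> U (m + n) - S" for n w
  proof -
    have "w \<in> U (m + n)" using that by auto
    then have "w \<in> U (m + (LEAST n. w \<in> U (m + n)))" "(LEAST n. w \<in> U (m + n)) \<le> n"
      by (auto intro: LeastI Least_le)
    with that show ?thesis unfolding Y_def by (intro eq) auto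
  qed
  have sol: "ode_solution Q S (U (m + n)) Y" "\<And>w. w \<in> U (m + n) - S \<Longrightarrow> deriv Y w = deriv (y n) w" for n
    using cong[OF U(1) y(1)[of n], of Y] Y by blast+
  have "ode_solution Q S (\<Union>(range (\<lambda>n. U (m + n)))) Y"
    by (rule solution_Union) (use sol U in auto)
  moreover have "(\<Union>n. U n) \<subseteq> \<Union>(range (\<lambda>n. U (m + n)))"
  proof
    fix w assume "w \<in> (\<Union>n. U n)"
    then obtain n where "w \<in> U n" by blast
    then have "w \<in> U (m + n)" using monoD[OF U(3), of n "m + n"] by auto
    then show "w \<in> \<Union>(range (\<lambda>n. U (m + n)))" by blast
  qed
  ultimately have "ode_solution Q S (\<Union>n. U n) Y" by (rule ode_solution_subset)
  moreover have "Y z = a" "deriv Y z = b" using Y[OF z[of 0]] sol(2)[OF z[of 0]] y by auto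
  ultimately show "\<exists>y. ode_solution Q S (\<Union>n. U n) y \<and> y z = a \<and> deriv y z = b" by blast
qed

text \<open>Squares are glued into rows, rows into rectangles, and growing rectangles exhaust the
  plane. Every overlap is again an open rectangle, hence connected, as \<open>glue\<close>
  demands.\<close>

lemma solvable_UNIV:
  assumes e: "e > 0" and loc: "\<And>c. ode_solvable Q S (ball c e)"
  shows "ode_solvable Q S UNIV"
proof -
  define R where "R a b c d = {z. a < Re z \<and> Re z < b \<and> c < Im z \<and> Im z < d}" for a b c d
  have R_box: "R a b c d = box (Complex a c) (Complex b d)" for a b c d
    by (auto simp: R_def box_complex_eq)
  have R: "open (R a b c d)" "connected (R a b c d)" for a b c d
    unfolding R_box by (auto intro: open_box convex_connected)
  have R_Int: "R a b c d \<inter> R a' b' c' d' = R (max a a') (min b b') (max c c') (min d d')"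
    for a b c d a' b' c' d' by (auto simp: R_def)
  have R_ne: "R a b c d \<noteq> {}" if "a < b" "c < d" for a b c d
  proof -
    have "Complex ((a + b) / 2) ((c + d) / 2) \<in> R a b c d" using that by (simp add: R_def)
    then show ?thesis by blast
  qed
  \<comment> \<open>Points of a square of side \<open>2 * h\<close> are closer than
    \<open>2 * h < e\<close> to its centre, so it fits into a disc of radius \<open>e\<close>.
    Consecutive pieces are arranged to overlap in a strip of width \<open>h\<close>.\<close>
  define h where "h = e / 3"
  have h: "h > 0" using e by (simp add: h_def)
  have small: "ode_solvable Q S (R a (a + 2 * h) c (c + 2 * h))" for a c
  proof (rule ode_solvable_subset[OF loc])
    show "R a (a + 2 * h) c (c + 2 * h) \<subseteq> ball (Complex (a + h) (c + h)) e"
    proof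
      fix z assume z: "z \<in> R a (a + 2 * h) c (c + 2 * h)"
      have "norm (z - Complex (a + h) (c + h)) \<le> \<bar>Re z - (a + h)\<bar> + \<bar>Im z - (c + h)\<bar>"
        using cmod_le[of "z - Complex (a + h) (c + h)"] by simp
      also have "\<dots> < e" using z by (auto simp: R_def h_def abs_if)
      finally show "z \<in> ball (Complex (a + h) (c + h)) e"
        by (simp add: dist_norm norm_minus_commute)
    qed
  qed
  have row: "ode_solvable Q S (R a (a + real (n + 2) * h) c (c + 2 * h))" for a c n
  proof (induction n)
    case 0
    then show ?case using small by simp
  next
    case (Suc n)
    let ?A = "R a (a + real (n + 2) * h) c (c + 2 * h)"
    let ?B = "R (a + real (n + 1) * h) (a + real (n + 1) * h + 2 * h) c (c + 2 * h)"
    define k where "k = real n * h"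
    have k: "k \<ge> 0" "real (n + 1) * h = k + h" "real (n + 2) * h = k + 2 * h" "real (Suc n + 2) * h = k + 3 * h"
      using h by (simp_all add: k_def algebra_simps)
    have "?A \<inter> ?B = R (a + real (n + 1) * h) (a + real (n + 2) * h) c (c + 2 * h)"
      unfolding R_def k using h k(1) by auto
    moreover have "\<dots> \<noteq> {}" unfolding k using h k(1) by (intro R_ne) auto
    ultimately have "ode_solvable Q S (?A \<union> ?B)"
      using glue[OF R R _ _ Suc.IH small] R by metis
    moreover have "R a (a + real (Suc n + 2) * h) c (c + 2 * h) \<subseteq> ?A \<union> ?B"
      unfolding k R_def using h k(1) by auto
    ultimately show ?case by (rule ode_solvable_subset)
  qed
  have rect: "ode_solvable Q S (R a (a + real (n + 2) * h) c (c + real (m + 2) * h))" for a c n m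
  proof (induction m)
    case 0
    then show ?case using row by simp
  next
    case (Suc m)
    let ?w = "a + real (n + 2) * h"
    let ?A = "R a ?w c (c + real (m + 2) * h)"
    let ?B = "R a ?w (c + real (m + 1) * h) (c + real (m + 1) * h + 2 * h)"
    define k where "k = real m * h"
    have k: "k \<ge> 0" "real (m + 1) * h = k + h" "real (m + 2) * h = k + 2 * h" "real (Suc m + 2) * h = k + 3 * h"
      using h by (simp_all add: k_def algebra_simps)
    have w: "a < ?w" using h by simp
    have "?A \<inter> ?B = R a ?w (c + real (m + 1) * h) (c + real (m + 2) * h)"
      unfolding R_def k using h k(1) by auto
    moreover have "\<dots> \<noteq> {}" unfolding k using h w by (intro R_ne) auto
    ultimately have "ode_solvable Q S (?A \<union> ?B)"
      using glue[OF R R _ _ Suc.IH row] R by metis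
    moreover have "R a ?w c (c + real (Suc m + 2) * h) \<subseteq> ?A \<union> ?B"
      unfolding k R_def using h k(1) by auto
    ultimately show ?case by (rule ode_solvable_subset)
  qed
  \<comment> \<open>\<open>B n\<close> has side \<open>(2 * n + 2) * h\<close>, which is why
    \<open>rect\<close> is instantiated with \<open>2 * n\<close>.\<close>
  define B where "B n = R (- (real (n + 1) * h)) (real (n + 1) * h) (- (real (n + 1) * h)) (real (n + 1) * h)" for n
  have "ode_solvable Q S (B n)" for n
    using rect[of "- (real (n + 1) * h)" "2 * n" "- (real (n + 1) * h)" "2 * n"]
    by (simp add: B_def algebra_simps)
  moreover have "mono B"
  proof (rule monoI)
    fix m n :: nat assume "m \<le> n"
    then have "real (m + 1) * h \<le> real (n + 1) * h" using h by (intro mult_right_mono) auto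
    then show "B m \<subseteq> B n" unfolding B_def R_def by auto
  qed
  moreover have "open (B n)" "connected (B n)" for n
    unfolding B_def by (rule R)+
  ultimately have "ode_solvable Q S (\<Union>n. B n)"
    by (intro solvable_incseq)
  moreover have "(\<Union>n. B n) = UNIV"
  proof (intro equalityI subsetI UNIV_I)
    fix z :: complex
    obtain n where n: "norm z / h < real n" using reals_Archimedean2 by blast
    then have "norm z < real n * h" using h by (simp add: field_simps)
    also have "\<dots> \<le> real (n + 1) * h" using h by simp
    finally have "z \<in> B n"
      using abs_Re_le_cmod[of z] abs_Im_le_cmod[of z] by (auto simp: B_def R_def)
    then show "z \<in> (\<Union>n. B n)" by blast
  qed
  ultimately show ?thesis by simp
qed

end

section \<open>Local solvability\<close>

text \<open>The difference quotient, completed by the derivative at \<open>s\<close>, is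
  holomorphic; forming it twice divides off the double zero.\<close>

lemma holomorphic_double_zero_factor:
  assumes "f holomorphic_on W" "open W" "s \<in> W" "f s = 0" "deriv f s = 0"
  obtains T where "T holomorphic_on W" "\<And>z. z \<in> W \<Longrightarrow> f z = (z - s)\<^sup>2 * T z"
proof -
  define g where "g z = (if z = s then deriv f s else (f z - f s) / (z - s))" for z
  define T where "T z = (if z = s then deriv g s else (g z - g s) / (z - s))" for z
  have "g holomorphic_on W"
    unfolding g_def using pole_lemma_open[OF assms(1,2), of s] by simp
  then have "T holomorphic_on W"
    unfolding T_def using pole_lemma_open[OF _ assms(2), of g s] by simp
  moreover have "f z = (z - s)\<^sup>2 * T z" for z
    using assms by (simp add: T_def g_def power2_eq_square)
  ultimately show ?thesis using that by blast
qed

lemma continuous_on_compact_bounded: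
  fixes f :: "complex \<Rightarrow> complex"
  assumes "continuous_on K f" "compact K"
  shows "\<exists>C. \<forall>z\<in>K. norm (f z) \<le> C"
  using compact_imp_bounded[OF compact_continuous_image[OF assms]] by (auto simp: bounded_iff)

context singular_ode
begin

lemma solvable_regular:
  assumes "cball c r \<inter> S = {}"
  shows "ode_solvable Q S (ball c r)"
  unfolding ode_solvable_def
proof (intro ballI allI)
  fix z0 a b assume z0: "z0 \<in> ball c r - S"
  let ?U = "ball c r"
  have US: "?U - S = ?U" using assms ball_subset_cball by blast
  have "Q holomorphic_on cball c r"
    using hol_Q by (rule holomorphic_on_subset) (use assms in auto)
  then obtain C where C: "\<And>z. z \<in> cball c r \<Longrightarrow> norm (Q z) \<le> C"
    using continuous_on_compact_bounded[OF holomorphic_on_imp_continuous_on compact_cball] by blast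
  have Q: "Q holomorphic_on ?U"
    using hol_Q by (rule holomorphic_on_subset) (use US in auto)
  \<comment> \<open>The parameter is a dummy: the coefficients ignore it, and the solution is read
    off at \<open>0\<close>.\<close>
  define coef where "coef = (\<lambda>p z (A::complex). if p then 1 else Q z)"
  have coef: "separated ?U UNIV (coef p)" for p
  proof -
    have "(\<lambda>z. if p then 1 else Q z) holomorphic_on ?U" using Q by (cases p) simp_all
    then show ?thesis unfolding coef_def by (rule separated_left)
  qed
  have bnd: "norm (coef p z A) \<le> max 1 C" if "z \<in> ?U" for p z A
    using C[of z] that by (auto simp: coef_def le_max_iff_disj)
  obtain F where F: "\<And>p A. F p z0 A = (if p then a else b)"
    "\<And>p z A. z \<in> ?U \<Longrightarrow> A \<in> UNIV \<Longrightarrow>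
       ((\<lambda>z. F p z A) has_field_derivative coef p z A * F (\<not> p) z A) (at z)"
    "\<And>p z. z \<in> ?U \<Longrightarrow> (\<lambda>A. F p z A) holomorphic_on UNIV"
    by (rule linear_system_solution[where coef = coef and init = "\<lambda>p. if p then a else b",
        OF open_ball convex_ball bounded_ball _ open_UNIV coef bnd]) (use z0 in auto)
  define y where "y = (\<lambda>z. F True z 0)"
  have d: "(y has_field_derivative F False z 0) (at z)"
    "((\<lambda>z. F False z 0) has_field_derivative Q z * y z) (at z)" if "z \<in> ?U" for z
    using F(2)[OF that, of 0 True] F(2)[OF that, of 0 False] by (simp_all add: y_def coef_def)
  have "y holomorphic_on ?U" using d(1) holomorphic_on_open[OF open_ball] by blast
  then have "y meromorphic_on ?U"
    by (simp add: analytic_on_open analytic_on_imp_meromorphic_on)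
  note sol = ode_solutionI[OF this, of S "\<lambda>z. F False z 0" Q, unfolded US, OF open_ball d]
  show "\<exists>y. ode_solution Q S ?U y \<and> y z0 = a \<and> deriv y z0 = b"
    using sol z0 F(1) by (intro exI[of _ y]) (auto simp: y_def)
qed

text \<open>
  The condition on \<open>a\<close> and \<open>R\<close> removes the logarithm at \<open>s\<close>. Let \<open>g = -1/u - a/2 + b u\<close>
  with \<open>u = z - s\<close> be the logarithmic derivative, up to second order, of a solution of
  exponent \<open>-1\<close>. Then \<open>Q - g' - g\<^sup>2 = u\<^sup>2 K\<close> with \<open>K\<close> holomorphic, and substituting
  \<open>y = e\<^sup>H X / u\<close>, \<open>y' = g y + u e\<^bsup>-H\<^esup> Y\<close> with \<open>H' = g + 1/u\<close> turns the equation into the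
  regular system \<open>X' = u\<^sup>2 e\<^bsup>-2H\<^esup> Y\<close>, \<open>Y' = K e\<^bsup>2H\<^esup> X\<close>.
\<close>

lemma solvable_apparent:
  assumes s: "s \<in> S" "cball s r \<inter> S \<subseteq> {s}" and W: "open W" "cball s r \<subseteq> W" "0 < r"
    and R: "R holomorphic_on W"
    and Q: "\<And>z. z \<in> ball s r - {s} \<Longrightarrow> Q z = 2 / (z - s)\<^sup>2 + a / (z - s) + R z"
    and no_log: "a ^ 3 / 4 - a * R s + deriv R s = 0"
  shows "ode_solvable Q S (ball s r)"
  unfolding ode_solvable_def
proof (intro ballI allI)
  fix z0 \<alpha> \<beta> assume z0: "z0 \<in> ball s r - S"
  let ?U = "ball s r"
  have sW: "s \<in> W" using W by auto
  have US: "?U - S = ?U - {s}" using s ball_subset_cball by blast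
  \<comment> \<open>This value cancels the constant coefficient of \<open>Q - g' - g\<^sup>2\<close>
    at \<open>s\<close>. The coefficient of \<open>z - s\<close> is then
    \<open>deriv R s + a * b\<close>, which vanishes precisely by \<open>no_log\<close>.\<close>
  define b where "b = a\<^sup>2 / 4 - R s"
  have ab: "a * b = - deriv R s"
    using no_log by (simp add: b_def power2_eq_square power3_eq_cube algebra_simps)
  have "((\<lambda>z. R z - R s - deriv R s * (z - s)) has_field_derivative (deriv R s - 0 - deriv R s)) (at s)"
    using holomorphic_derivI[OF R W(1) sW] by (auto intro!: derivative_eq_intros)
  then have "deriv (\<lambda>z. R z - R s - deriv R s * (z - s)) s = 0"
    by (simp add: DERIV_imp_deriv)
  then obtain T where T: "T holomorphic_on W"
    "\<And>z. z \<in> W \<Longrightarrow> R z - R s - deriv R s * (z - s) = (z - s)\<^sup>2 * T z"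
    using holomorphic_double_zero_factor[of "\<lambda>z. R z - R s - deriv R s * (z - s)" W s thesis]
      R W(1) sW by (simp add: holomorphic_intros)
  define K where "K = (\<lambda>z. T z - b\<^sup>2)"
  \<comment> \<open>\<open>E\<close> is \<open>e^H\<close>: the exponent is the primitive of
    \<open>g + 1 / (z - s)\<close> that vanishes at \<open>s\<close>, so \<open>E\<close> is
    holomorphic and nonzero there.\<close>
  define E where "E = (\<lambda>z. exp (- a / 2 * (z - s) + b * (z - s)\<^sup>2 / 2))"
  define g where "g = (\<lambda>z. - 1 / (z - s) - a / 2 + b * (z - s))"
  have E0: "E z \<noteq> 0" for z by (simp add: E_def)
  have dE: "(E has_field_derivative (- a / 2 + b * (z - s)) * E z) (at z)" for z
  proof -
    have "((\<lambda>z. - a / 2 * (z - s) + b * (z - s)\<^sup>2 / 2) has_field_derivative (- a / 2 + b * (z - s))) (at z)"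
      by (auto intro!: derivative_eq_intros)
    from DERIV_fun_exp[OF this] show ?thesis by (simp add: E_def mult.commute)
  qed
  have Kg: "Q z = 1 / (z - s)\<^sup>2 + b + (g z)\<^sup>2 + (z - s)\<^sup>2 * K z" if "z \<in> ?U - {s}" for z
  proof -
    have u: "z - s \<noteq> 0" "z \<in> W" using that W by auto
    have eq: "R z = R s + deriv R s * (z - s) + (z - s)\<^sup>2 * T z"
      using T(2)[OF u(2)] by (simp add: algebra_simps)
    have eq2: "R s = a\<^sup>2 / 4 - b" "deriv R s = - (a * b)" using ab by (simp_all add: b_def)
    define w where "w = z - s"
    have w: "w \<noteq> 0" using u by (simp add: w_def)
    show ?thesis
      unfolding Q[OF that] eq eq2 K_def g_def w_def[symmetric] using w
      by (simp add: field_simps power2_eq_square power3_eq_cube power4_eq_xxxx)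
  qed
  \<comment> \<open>Both coefficients are holomorphic across \<open>s\<close>; the singularity
    survives only in the change of unknowns.\<close>
  define coef where "coef = (\<lambda>p z (A::complex). if p then (z - s)\<^sup>2 / (E z)\<^sup>2 else K z * (E z)\<^sup>2)"
  have K: "K holomorphic_on W" unfolding K_def using T by (intro holomorphic_intros)
  have E: "E holomorphic_on W" unfolding E_def by (intro holomorphic_intros) auto
  have hol: "(\<lambda>z. coef p z 0) holomorphic_on W" for p
    using K E E0 unfolding coef_def by (cases p) (auto intro!: holomorphic_intros)
  obtain C where C: "\<And>p z. z \<in> cball s r \<Longrightarrow> norm (coef p z 0) \<le> C"
  proof -
    have "continuous_on (cball s r) (\<lambda>z. coef p z 0)" for p
      using hol[of p] W(2) holomorphic_on_imp_continuous_on holomorphic_on_subset by blast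
    then have "\<exists>C. \<forall>z\<in>cball s r. norm (coef p z 0) \<le> C" for p
      by (rule continuous_on_compact_bounded[OF _ compact_cball])
    then obtain C where C: "\<And>p z. z \<in> cball s r \<Longrightarrow> norm (coef p z 0) \<le> C p" by metis
    show ?thesis
    proof (rule that[of "max (C True) (C False)"])
      show "norm (coef p z 0) \<le> max (C True) (C False)" if "z \<in> cball s r" for p z
        using C[OF that, of p] by (cases p) auto
    qed
  qed
  have sep: "separated ?U UNIV (coef p)" for p
  proof -
    have "(\<lambda>z. coef p z 0) holomorphic_on ?U"
      using hol by (rule holomorphic_on_subset) (use W ball_subset_cball in blast)
    from separated_left[OF this, of UNIV] show ?thesis by (simp add: coef_def)
  qed
  have bnd: "norm (coef p z A) \<le> C" if "z \<in> ?U" for p z A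
    using C[of z p] that by (simp add: coef_def)
  have z0': "z0 \<in> ?U" "z0 \<noteq> s" using z0 s by auto
  \<comment> \<open>The initial values invert the change of unknowns at \<open>z0\<close>, which is
    possible because \<open>z0\<close> differs from \<open>s\<close>.\<close>
  obtain F where F: "\<And>p A. F p z0 A = (if p then (z0 - s) * \<alpha> / E z0 else (\<beta> - g z0 * \<alpha>) / (z0 - s) * E z0)"
    "\<And>p z A. z \<in> ?U \<Longrightarrow> A \<in> UNIV \<Longrightarrow>
       ((\<lambda>z. F p z A) has_field_derivative coef p z A * F (\<not> p) z A) (at z)"
    "\<And>p z. z \<in> ?U \<Longrightarrow> (\<lambda>A. F p z A) holomorphic_on UNIV"
    by (rule linear_system_solution[where coef = coef and init = "\<lambda>p. if p then (z0 - s) * \<alpha> / E z0 else (\<beta> - g z0 * \<alpha>) / (z0 - s) * E z0",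
        OF open_ball convex_ball bounded_ball z0'(1) open_UNIV sep bnd]) (assumption | rule that)+
  define X where "X = (\<lambda>z. F True z 0)"
  define Y where "Y = (\<lambda>z. F False z 0)"
  have dX: "(X has_field_derivative (z - s)\<^sup>2 / (E z)\<^sup>2 * Y z) (at z)"
    and dY: "(Y has_field_derivative K z * (E z)\<^sup>2 * X z) (at z)" if "z \<in> ?U" for z
    using F(2)[OF that, of 0 True] F(2)[OF that, of 0 False] by (simp_all add: X_def Y_def coef_def)
  define y where "y = (\<lambda>z. E z * X z / (z - s))"
  define y' where "y' = (\<lambda>z. g z * y z + (z - s) * Y z / E z)"
  have dy: "(y has_field_derivative y' z) (at z)" if "z \<in> ?U - S" for z
  proof -
    have z: "z \<in> ?U" "z \<noteq> s" using that s by auto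
    define u where "u = z - s"
    have u: "u \<noteq> 0" using z by (simp add: u_def)
    have "((\<lambda>z. z - s) has_field_derivative 1) (at z)" by (auto intro!: derivative_eq_intros)
    from DERIV_divide[OF DERIV_mult[OF dE dX[OF z(1)]] this]
    have "(y has_field_derivative (((- a / 2 + b * u) * E z * X z + u\<^sup>2 / (E z)\<^sup>2 * Y z * E z) * u
        - E z * X z * 1) / (u * u)) (at z)"
      using u by (simp add: u_def y_def)
    also have "(((- a / 2 + b * u) * E z * X z + u\<^sup>2 / (E z)\<^sup>2 * Y z * E z) * u
        - E z * X z * 1) / (u * u) = y' z"
      unfolding y'_def y_def g_def u_def[symmetric] using u E0[of z]
      by (simp add: field_simps power2_eq_square)
    finally show ?thesis .
  qed
  have dy': "(y' has_field_derivative Q z * y z) (at z)" if "z \<in> ?U - S" for z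
  proof -
    have z: "z \<in> ?U" "z \<noteq> s" using that s by auto
    have dg: "(g has_field_derivative 1 / (z - s)\<^sup>2 + b) (at z)"
      unfolding g_def using z by (auto intro!: derivative_eq_intros simp: power2_eq_square)
    have "(y' has_field_derivative (1 / (z - s)\<^sup>2 + b) * y z + y' z * g z +
       (((1 - 0) * Y z + K z * (E z)\<^sup>2 * X z * (z - s)) * E z - (z - s) * Y z * ((- a / 2 + b * (z - s)) * E z))
         / (E z * E z)) (at z)"
      unfolding y'_def
      by (rule derivative_eq_intros dE dY dg dy[OF that, unfolded y'_def] z refl E0)+
    also have "(1 / (z - s)\<^sup>2 + b) * y z + y' z * g z +
       (((1 - 0) * Y z + K z * (E z)\<^sup>2 * X z * (z - s)) * E z - (z - s) * Y z * ((- a / 2 + b * (z - s)) * E z))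
         / (E z * E z) = (1 / (z - s)\<^sup>2 + b + (g z)\<^sup>2 + (z - s)\<^sup>2 * K z) * y z"
    proof -
      define u where "u = z - s"
      have u: "u \<noteq> 0" using z by (simp add: u_def)
      have gu: "(- a / 2 + b * u) * u = g z * u + 1" using u by (simp add: g_def u_def field_simps)
      have "(((1 - 0) * Y z + K z * (E z)\<^sup>2 * X z * u) * E z - u * Y z * ((- a / 2 + b * u) * E z))
          / (E z * E z) = (Y z + K z * (E z)\<^sup>2 * X z * u - ((- a / 2 + b * u) * u) * Y z) / E z"
        using E0[of z] by (simp add: field_simps)
      also have "\<dots> = u\<^sup>2 * K z * y z - g z * (u * Y z / E z)"
        unfolding gu using E0[of z] u
        by (simp add: y_def u_def field_simps power2_eq_square)
      finally show ?thesis
        unfolding u_def by (simp add: y'_def algebra_simps power2_eq_square)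
    qed
    finally show ?thesis using Kg[of z] z by simp
  qed
  have "E holomorphic_on ?U" "X holomorphic_on ?U"
    using dE dX holomorphic_on_open[OF open_ball] by blast+
  then have "E meromorphic_on ?U" "X meromorphic_on ?U"
    by (auto intro!: analytic_on_imp_meromorphic_on simp: analytic_on_open)
  moreover have "(\<lambda>z. z - s) meromorphic_on ?U"
    by (intro meromorphic_intros)
  ultimately have m: "y meromorphic_on ?U"
    unfolding y_def by (intro meromorphic_on_divide meromorphic_on_mult)
  note sol = ode_solutionI[OF m open_diff[OF open_ball] dy dy']
  have "y z0 = \<alpha>" "y' z0 = \<beta>"
    using z0' E0[of z0] by (simp_all add: y_def y'_def X_def Y_def F(1))
  then show "\<exists>y. ode_solution Q S ?U y \<and> y z0 = \<alpha> \<and> deriv y z0 = \<beta>"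
    using sol z0 by blast
qed

end

section \<open>The lattice\<close>

lemma higher_deriv_sum:
  assumes "finite X" "\<And>w. w \<in> X \<Longrightarrow> f w holomorphic_on S" "open S" "z \<in> S"
  shows "(deriv ^^ m) (\<lambda>z. \<Sum>w\<in>X. f w z) z = (\<Sum>w\<in>X. (deriv ^^ m) (f w) z)"
  using assms(1,2)
proof (induction X)
  case empty
  then show ?case by (simp add: higher_deriv_const)
next
  case (insert x X)
  have "(deriv ^^ m) (\<lambda>z. f x z + (\<Sum>w\<in>X. f w z)) z =
      (deriv ^^ m) (f x) z + (deriv ^^ m) (\<lambda>z. \<Sum>w\<in>X. f w z) z"
    using insert by (intro higher_deriv_add[OF _ _ assms(3,4)] holomorphic_intros) auto
  with insert show ?case by simp
qed

text \<open>Weierstrass' convergence theorem along the net of finite subsets, to match the unordered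
  sums defining \<open>weierstrass_wp\<close> and \<open>weierstrass_zeta\<close>. A majorant on
  small discs is enough, since the conclusions are local.\<close>

lemma holomorphic_infsum:
  fixes f :: "'a \<Rightarrow> complex \<Rightarrow> complex"
  assumes S: "open S" and hol: "\<And>w. w \<in> I \<Longrightarrow> f w holomorphic_on S"
    and maj: "\<And>z. z \<in> S \<Longrightarrow> \<exists>r>0. \<exists>M. cball z r \<subseteq> S \<and> M summable_on I \<and>
      (\<forall>w\<in>I. \<forall>u\<in>cball z r. norm (f w u) \<le> M w)"
  shows "(\<lambda>z. \<Sum>\<^sub>\<infinity>w\<in>I. f w z) holomorphic_on S"
    and "\<And>z m. z \<in> S \<Longrightarrow>
      ((\<lambda>w. (deriv ^^ m) (f w) z) has_sum (deriv ^^ m) (\<lambda>z. \<Sum>\<^sub>\<infinity>w\<in>I. f w z) z) I"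
proof -
  let ?F = "\<lambda>z. \<Sum>\<^sub>\<infinity>w\<in>I. f w z"
  have *: "?F field_differentiable (at z) \<and>
      ((\<lambda>w. (deriv ^^ m) (f w) z) has_sum (deriv ^^ m) ?F z) I" if z: "z \<in> S" for z m
  proof -
    obtain r M where r: "r > 0" "cball z r \<subseteq> S" and M: "M summable_on I"
      "\<And>w u. w \<in> I \<Longrightarrow> u \<in> cball z r \<Longrightarrow> norm (f w u) \<le> M w"
      using maj[OF z] by blast
    have bS: "ball z r \<subseteq> S" using r ball_subset_cball[of z r] by blast
    have ul: "uniform_limit (cball z r) (\<lambda>X u. \<Sum>w\<in>X. f w u) ?F (finite_subsets_at_top I)"
      using M(2,1) by (rule Weierstrass_m_test_general)
    have ev: "\<forall>\<^sub>F X in finite_subsets_at_top I. finite X \<and> X \<subseteq> I"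
      by (rule eventually_finite_subsets_at_top_weakI) auto
    have hol': "(\<lambda>u. \<Sum>w\<in>X. f w u) holomorphic_on S" if "X \<subseteq> I" for X
      using hol that by (intro holomorphic_intros) auto
    have "?F holomorphic_on ball z r"
    proof (rule holomorphic_uniform_limit[OF _ ul])
      show "\<forall>\<^sub>F X in finite_subsets_at_top I. continuous_on (cball z r) (\<lambda>u. \<Sum>w\<in>X. f w u) \<and>
          (\<lambda>u. \<Sum>w\<in>X. f w u) holomorphic_on ball z r"
        using ev
      proof eventually_elim
        case (elim X)
        then have h: "(\<lambda>u. \<Sum>w\<in>X. f w u) holomorphic_on S" by (intro hol') simp
        show ?case
          using holomorphic_on_imp_continuous_on[OF holomorphic_on_subset[OF h r(2)]]
            holomorphic_on_subset[OF h bS] by blast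
      qed
    qed auto
    then have 1: "?F field_differentiable (at z)"
      by (rule holomorphic_on_imp_differentiable_at) (use r in auto)
    have lim: "((\<lambda>X. (deriv ^^ m) (\<lambda>u. \<Sum>w\<in>X. f w u) z) \<longlongrightarrow> (deriv ^^ m) ?F z) (finite_subsets_at_top I)"
    proof (rule higher_deriv_complex_uniform_limit)
      show "uniform_limit (ball z r) (\<lambda>X u. \<Sum>w\<in>X. f w u) ?F (finite_subsets_at_top I)"
        using ul ball_subset_cball by (rule uniform_limit_on_subset)
      show "\<forall>\<^sub>F X in finite_subsets_at_top I. (\<lambda>u. \<Sum>w\<in>X. f w u) holomorphic_on ball z r"
        using ev
        by eventually_elim (rule holomorphic_on_subset[OF hol'], use bS in auto)
    qed (use r in auto)
    have eq: "\<forall>\<^sub>F X in finite_subsets_at_top I.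
        (deriv ^^ m) (\<lambda>u. \<Sum>w\<in>X. f w u) z = (\<Sum>w\<in>X. (deriv ^^ m) (f w) z)"
      using ev by eventually_elim (rule higher_deriv_sum[OF _ hol S z], auto)
    have "((\<lambda>w. (deriv ^^ m) (f w) z) has_sum (deriv ^^ m) ?F z) I"
      unfolding has_sum_def using lim by (simp add: tendsto_cong[OF eq])
    with 1 show ?thesis by blast
  qed
  show "?F holomorphic_on S"
    unfolding holomorphic_on_def using * field_differentiable_at_within by blast
  show "\<And>z m. z \<in> S \<Longrightarrow> ((\<lambda>w. (deriv ^^ m) (f w) z) has_sum (deriv ^^ m) ?F z) I"
    using * by blast
qed

section \<open>Lattice arithmetic\<close>

lemma lattice_add: "u \<in> lattice \<tau> \<Longrightarrow> v \<in> lattice \<tau> \<Longrightarrow> u + v \<in> lattice \<tau>"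
proof -
  assume "u \<in> lattice \<tau>" "v \<in> lattice \<tau>"
  then obtain a b c d :: int where "u = of_int a + of_int b * \<tau>" "v = of_int c + of_int d * \<tau>"
    by (auto simp: lattice_def)
  then have "u + v = of_int (a + c) + of_int (b + d) * \<tau>" by (simp add: algebra_simps)
  then show ?thesis unfolding lattice_def by blast
qed

lemma lattice_uminus: "u \<in> lattice \<tau> \<Longrightarrow> - u \<in> lattice \<tau>"
proof -
  assume "u \<in> lattice \<tau>"
  then obtain a b :: int where "u = of_int a + of_int b * \<tau>"
    by (auto simp: lattice_def)
  then have "- u = of_int (- a) + of_int (- b) * \<tau>" by (simp add: algebra_simps)
  then show ?thesis unfolding lattice_def by blast
qed

lemma lattice_uminus_iff [simp]: "- u \<in> lattice \<tau> \<longleftrightarrow> u \<in> lattice \<tau>"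
  using lattice_uminus[of u \<tau>] lattice_uminus[of "- u" \<tau>] by auto

lemma lattice_diff: "u \<in> lattice \<tau> \<Longrightarrow> v \<in> lattice \<tau> \<Longrightarrow> u - v \<in> lattice \<tau>"
  using lattice_add[of u \<tau> "- v"] by simp

lemma lattice_add_iff: "v \<in> lattice \<tau> \<Longrightarrow> u + v \<in> lattice \<tau> \<longleftrightarrow> u \<in> lattice \<tau>"
  using lattice_add[of u \<tau> v] lattice_diff[of "u + v" \<tau> v] by auto

lemma zero_in_lattice [simp]: "0 \<in> lattice \<tau>"
  unfolding lattice_def by (rule CollectI, rule exI[of _ 0], rule exI[of _ 0]) simp

lemma one_in_lattice [simp]: "1 \<in> lattice \<tau>"
  unfolding lattice_def by (rule CollectI, rule exI[of _ 1], rule exI[of _ 0]) simp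

lemma tau_in_lattice [simp]: "\<tau> \<in> lattice \<tau>"
  unfolding lattice_def by (rule CollectI, rule exI[of _ 0], rule exI[of _ 1]) simp

text \<open>The exponent is half of \<open>-3\<close>: the lattice sum of
  \<open>1 / norm w ^ 3\<close> is going to be dominated by a product of two such series, one for
  each coordinate.\<close>

lemma summable_on_int_powr: "(\<lambda>m::int. (1 + \<bar>real_of_int m\<bar>) powr (-3/2)) summable_on UNIV"
proof -
  let ?f = "\<lambda>m::int. (1 + \<bar>real_of_int m\<bar>) powr (-3/2)"
  have "summable (\<lambda>n. real n powr (-3/2))" by (subst summable_real_powr_iff) simp
  then have "summable (\<lambda>n. real (Suc n) powr (-3/2))" by (subst summable_Suc_iff)
  then have "summable (\<lambda>n. (1 + real n) powr (-3/2))" by simp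
  then have n: "(\<lambda>n. (1 + real n) powr (-3/2)) summable_on UNIV"
    by (subst summable_on_UNIV_nonneg_real_iff) auto
  have "?f summable_on (range int)"
    by (subst summable_on_reindex) (use n in \<open>auto simp: o_def\<close>)
  moreover have "?f summable_on (range (\<lambda>n. - int n))"
    by (subst summable_on_reindex) (use n in \<open>auto simp: o_def inj_on_def\<close>)
  ultimately have "?f summable_on range int \<union> range (\<lambda>n. - int n)"
    by (intro summable_on_union)
  also have "range int \<union> range (\<lambda>n. - int n) = UNIV"
  proof -
    have "m \<in> range int \<union> range (\<lambda>n. - int n)" for m :: int
      by (cases m rule: int_cases2) auto
    then show ?thesis by blast
  qed
  finally show ?thesis .
qed

section \<open>Norm estimates and summability over the lattice\<close>

locale complex_torus =
  fixes \<tau> :: complex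
  assumes Im_pos: "Im \<tau> > 0"
begin

abbreviation "L \<equiv> lattice \<tau>"

text \<open>For \<open>w = a + b * \<tau>\<close> this adds up the bounds
  \<open>\<bar>b\<bar> \<le> norm w / Im \<tau>\<close> and
  \<open>\<bar>a\<bar> \<le> norm w + \<bar>b\<bar> * norm \<tau>\<close>.\<close>

definition "lattice_const = 1 / Im \<tau> + 1 + norm \<tau> / Im \<tau>"

text \<open>The imaginary part controls \<open>b\<close>, and then the triangle inequality controls
  \<open>a\<close>. Real coefficients make the bound yield also the independence of \<open>1\<close>
  and \<open>\<tau>\<close> over the reals.\<close>

lemma lattice_norm_ge:
  "\<bar>a\<bar> + \<bar>b\<bar> \<le> lattice_const * norm (of_real a + of_real b * \<tau>)"
proof -
  let ?w = "of_real a + of_real b * \<tau>"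
  have "\<bar>b\<bar> * Im \<tau> \<le> norm ?w"
    using abs_Im_le_cmod[of ?w] Im_pos by (simp add: abs_mult)
  then have b: "\<bar>b\<bar> \<le> norm ?w / Im \<tau>" using Im_pos by (simp add: field_simps)
  have "\<bar>a\<bar> = norm (?w - of_real b * \<tau>)" by simp
  also have "\<dots> \<le> norm ?w + \<bar>b\<bar> * norm \<tau>"
    using norm_triangle_ineq4[of ?w "of_real b * \<tau>"] by (simp add: norm_mult)
  also have "\<dots> \<le> norm ?w + norm ?w / Im \<tau> * norm \<tau>"
    using b by (intro add_left_mono mult_right_mono) auto
  finally show ?thesis using b by (simp add: lattice_const_def algebra_simps)
qed

lemma lattice_const_pos: "lattice_const > 0"
  unfolding lattice_const_def using Im_pos by (intro add_pos_nonneg) auto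

lemma real_combination_eq_0:
  "of_real a + of_real b * \<tau> = 0 \<Longrightarrow> a = 0 \<and> b = 0"
  using lattice_norm_ge[of a b] abs_ge_zero[of a] abs_ge_zero[of b] by (auto simp: abs_if split: if_splits)

lemma inj_lattice: "inj (\<lambda>(m::int, n::int). of_int m + of_int n * \<tau>)"
proof (rule injI, clarify)
  fix a b c d :: int assume "of_int a + of_int b * \<tau> = of_int c + of_int d * \<tau>"
  then have "of_real (real_of_int (a - c)) + of_real (real_of_int (b - d)) * \<tau> = 0"
    by (simp add: algebra_simps)
  from real_combination_eq_0[OF this] show "a = c \<and> b = d" by simp
qed

lemma lattice_image: "L = (\<lambda>(m::int, n::int). of_int m + of_int n * \<tau>) ` UNIV"
  by (auto simp: lattice_def image_def)

text \<open>For the periodicity of \<open>wp\<close>, where an additive constant is determined by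
  evaluating at half a period.\<close>

lemma half_period_notin_lattice: "1/2 \<notin> L" "\<tau>/2 \<notin> L"
proof -
  show "1/2 \<notin> L"
  proof
    assume "1/2 \<in> L"
    then obtain m n :: int where "1/2 = of_int m + of_int n * \<tau>" by (auto simp: lattice_def)
    then have "of_real (real_of_int m - 1/2) + of_real (real_of_int n) * \<tau> = 0"
      by (simp add: algebra_simps)
    from real_combination_eq_0[OF this] have "real_of_int (2 * m) = 1" by simp
    then have "2 * m = 1" by linarith
    then show False by presburger
  qed
  show "\<tau>/2 \<notin> L"
  proof
    assume "\<tau>/2 \<in> L"
    then obtain m n :: int where "\<tau>/2 = of_int m + of_int n * \<tau>" by (auto simp: lattice_def)
    then have "of_real (real_of_int m) + of_real (real_of_int n - 1/2) * \<tau> = 0"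
      by (simp add: algebra_simps)
    from real_combination_eq_0[OF this] have "real_of_int (2 * n) = 1" by simp
    then have "2 * n = 1" by linarith
    then show False by presburger
  qed
qed

lemma finite_lattice_ball: "finite {w \<in> L. norm w \<le> R}"
proof -
  let ?N = "\<lceil>lattice_const * R\<rceil>"
  have "{w \<in> L. norm w \<le> R} \<subseteq> (\<lambda>(m::int, n::int). of_int m + of_int n * \<tau>) ` ({-?N..?N} \<times> {-?N..?N})"
  proof
    fix w assume "w \<in> {w \<in> L. norm w \<le> R}"
    then obtain m n :: int where w: "w = of_int m + of_int n * \<tau>" "norm w \<le> R"
      by (auto simp: lattice_def)
    have "\<bar>real_of_int m\<bar> + \<bar>real_of_int n\<bar> \<le> lattice_const * norm w"
      using lattice_norm_ge[of "real_of_int m" "real_of_int n"] w by simp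
    also have "\<dots> \<le> lattice_const * R" using w lattice_const_pos by simp
    finally have "m \<in> {-?N..?N}" "n \<in> {-?N..?N}" by (auto simp: abs_le_iff) linarith+
    with w show "w \<in> (\<lambda>(m::int, n::int). of_int m + of_int n * \<tau>) ` ({-?N..?N} \<times> {-?N..?N})"
      by (intro image_eqI[of _ _ "(m, n)"]) auto
  qed
  then show ?thesis by (rule finite_subset) auto
qed

lemma lattice_not_islimpt: "\<not> z islimpt L"
proof -
  have "L \<inter> ball z 1 \<subseteq> {w \<in> L. norm w \<le> norm z + 1}"
  proof
    fix w assume w: "w \<in> L \<inter> ball z 1"
    then have "norm (w - z) < 1" by (simp add: dist_norm norm_minus_commute)
    then show "w \<in> {w \<in> L. norm w \<le> norm z + 1}"
      using w norm_triangle_ineq[of "w - z" z] by simp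
  qed
  then have "finite (L \<inter> ball z 1)" using finite_lattice_ball finite_subset by blast
  then show ?thesis unfolding islimpt_eq_infinite_ball by (metis zero_less_one)
qed

lemma closed_lattice_subset: "X \<subseteq> L \<Longrightarrow> closed X"
  using lattice_not_islimpt islimpt_subset closed_limpt by metis

lemma open_compl_lattice: "open (- L)" "open (- (L - {0}))"
  by (intro open_Compl closed_lattice_subset; blast)+

lemma connected_compl_lattice: "connected (- L)"
proof -
  have "connected (UNIV - L)"
    by (rule connected_open_diff_countable)
       (auto simp: lattice_image intro: countable_image connected_UNIV)
  then show ?thesis by (simp add: Compl_eq_Diff_UNIV)
qed

text \<open>Off the origin \<open>s = \<bar>m\<bar> + \<bar>n\<bar>\<close> is at least
  \<open>1\<close>, so \<open>(1 + \<bar>m\<bar>) * (1 + \<bar>n\<bar>) \<le> (2 *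
  s)\<^sup>2\<close>, and \<open>s\<close> is at most a constant times \<open>norm w\<close>. The
  power \<open>3/2\<close> of this bounds each term by a product that can be summed coordinate by
  coordinate.\<close>

lemma summable_lattice: "(\<lambda>w. 1 / norm w ^ 3) summable_on (L - {0})"
proof -
  let ?h = "\<lambda>(m::int, n::int). of_int m + of_int n * \<tau>"
  let ?\<phi> = "\<lambda>m::int. (1 + \<bar>real_of_int m\<bar>) powr (-3/2)"
  have im: "L - {0} = ?h ` (UNIV - {(0, 0)})"
    using image_set_diff[OF inj_lattice, of UNIV "{(0,0)}"] by (simp add: lattice_image)
  have "(\<lambda>(m, n). ?\<phi> m * ?\<phi> n) summable_on UNIV \<times> UNIV"
  proof (rule summable_on_SigmaI)
    show "((\<lambda>n. case (m, n) of (m, n) \<Rightarrow> ?\<phi> m * ?\<phi> n) has_sum ?\<phi> m * (\<Sum>\<^sub>\<infinity>n\<in>UNIV. ?\<phi> n)) UNIV" for m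
      using has_sum_cmult_right[OF has_sum_infsum[OF summable_on_int_powr]] by simp
    show "(\<lambda>m. ?\<phi> m * (\<Sum>\<^sub>\<infinity>n\<in>UNIV. ?\<phi> n)) summable_on UNIV"
      using summable_on_int_powr by (rule summable_on_cmult_left)
  qed auto
  then have "(\<lambda>x. (2 * lattice_const) ^ 3 * (case x of (m, n) \<Rightarrow> ?\<phi> m * ?\<phi> n)) summable_on (UNIV - {(0, 0)})"
    by (intro summable_on_cmult_right) (rule summable_on_subset, auto)
  then have "((\<lambda>w. 1 / norm w ^ 3) \<circ> ?h) summable_on (UNIV - {(0, 0)})"
  proof (rule summable_on_comparison_test)
    fix x :: "int \<times> int" assume x: "x \<in> UNIV - {(0, 0)}"
    obtain m n where mn: "x = (m, n)" by force
    let ?w = "of_int m + of_int n * \<tau>"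
    let ?s = "\<bar>real_of_int m\<bar> + \<bar>real_of_int n\<bar>"
    let ?P = "(1 + \<bar>real_of_int m\<bar>) * (1 + \<bar>real_of_int n\<bar>)"
    have "1 \<le> \<bar>m\<bar> + \<bar>n\<bar>" using x mn by auto
    then have s1: "1 \<le> ?s" by (metis of_int_1_le_iff of_int_abs of_int_add)
    have "?P \<le> (1 + ?s)\<^sup>2" by (simp add: power2_eq_square algebra_simps)
    also have "\<dots> \<le> (2 * ?s)\<^sup>2" using s1 by (intro power_mono) auto
    also have "\<dots> \<le> (2 * (lattice_const * norm ?w))\<^sup>2"
      using lattice_norm_ge[of "real_of_int m" "real_of_int n"] by (intro power_mono) auto
    finally have P: "?P \<le> (2 * lattice_const * norm ?w)\<^sup>2" by (simp add: mult.assoc)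
    have w0: "norm ?w > 0"
    proof -
      have "0 < lattice_const * norm ?w"
        using s1 lattice_norm_ge[of "real_of_int m" "real_of_int n"] by simp
      then show ?thesis using lattice_const_pos by (simp add: zero_less_mult_iff)
    qed
    have pos: "2 * lattice_const * norm ?w > 0" using w0 lattice_const_pos by simp
    have "?P powr (3/2) \<le> ((2 * lattice_const * norm ?w)\<^sup>2) powr (3/2)"
      using P by (intro powr_mono2) auto
    also have "\<dots> = (2 * lattice_const * norm ?w) ^ 3"
      using pos using powr_realpow[OF pos, of 2] powr_realpow[OF pos, of 3]
        powr_powr[of "2 * lattice_const * norm ?w" 2 "3/2"] by simp
    finally have le: "?P powr (3/2) \<le> (2 * lattice_const * norm ?w) ^ 3" .
    have "1 / norm ?w ^ 3 \<le> (2 * lattice_const) ^ 3 * (1 / ?P powr (3/2))"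
    proof -
      have P0: "?P powr (3/2) > 0" by (auto simp: mult_pos_pos add_pos_nonneg)
      have w3: "norm ?w ^ 3 > 0" using w0 by simp
      have "1 * ?P powr (3/2) \<le> (2 * lattice_const) ^ 3 * norm ?w ^ 3"
        using le by (simp add: power_mult_distrib)
      then show ?thesis
        using P0 w3 by (simp add: pos_divide_le_eq pos_le_divide_eq mult_ac del: zero_less_norm_iff)
    qed
    also have "1 / ?P powr (3/2) = ?\<phi> m * ?\<phi> n"
      by (simp add: powr_mult powr_minus_divide)
    finally show "((\<lambda>w. 1 / norm w ^ 3) \<circ> ?h) x \<le> (2 * lattice_const) ^ 3 * (case x of (m, n) \<Rightarrow> ?\<phi> m * ?\<phi> n)"
      by (simp add: mn)
  qed auto
  then show ?thesis
    unfolding im using inj_lattice by (subst summable_on_reindex) (auto intro: inj_on_subset)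
qed

end

section \<open>Weierstrass functions\<close>

context complex_torus
begin

abbreviation "wp \<equiv> weierstrass_wp \<tau>"
abbreviation "zeta \<equiv> weierstrass_zeta \<tau>"

text \<open>The zeta function without its pole at the origin. Adding \<open>1 / z\<close> gives
  \<open>zeta\<close>, and its derivative gives \<open>wp\<close>, so a single majorant serves
  both.\<close>

definition zeta_reg :: "complex \<Rightarrow> complex" where
  "zeta_reg z = (\<Sum>\<^sub>\<infinity>w\<in>L - {0}. 1 / (z - w) + 1 / w + z / w^2)"

text \<open>The three fractions combine to \<open>u\<^sup>2 / ((u - w) * w\<^sup>2)\<close>, which
  is of order \<open>1 / norm w ^ 3\<close> as soon as \<open>norm (u - w)\<close> is at least a
  multiple of \<open>norm w\<close>.\<close>

lemma zeta_reg_majorant: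
  assumes z: "z \<in> - (L - {0})"
  shows "\<exists>r>0. \<exists>M. cball z r \<subseteq> - (L - {0}) \<and> M summable_on (L - {0}) \<and>
    (\<forall>w\<in>L - {0}. \<forall>u\<in>cball z r. norm (1 / (u - w) + 1 / w + u / w^2) \<le> M w)"
proof -
  obtain \<epsilon> where \<epsilon>: "\<epsilon> > 0" "cball z \<epsilon> \<subseteq> - (L - {0})"
    using open_compl_lattice(2) z open_contains_cball by blast
  define r where "r = \<epsilon> / 2"
  have r: "r > 0" "r < \<epsilon>" using \<epsilon> by (auto simp: r_def)
  define R where "R = norm z + r"
  have R: "R > 0" "r \<le> R" unfolding R_def using r norm_ge_zero[of z] by linarith+
  \<comment> \<open>\<open>1/2\<close> serves the lattice points with \<open>norm w > 2 * R\<close>,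
    and \<open>r / (2 * R)\<close> the others, whose distance from the disc is at least
    \<open>r\<close> because \<open>r\<close> is half of \<open>\<epsilon>\<close>.\<close>
  define \<delta> where "\<delta> = min (1/2) (r / (2 * R))"
  have \<delta>: "\<delta> > 0" "\<delta> \<le> 1/2" "\<delta> \<le> r / (2 * R)" unfolding \<delta>_def using r R by auto
  have u: "norm u \<le> R" if "u \<in> cball z r" for u
    using that norm_triangle_ineq[of z "u - z"] by (simp add: R_def dist_norm norm_minus_commute)
  have far: "norm (u - w) \<ge> \<delta> * norm w" if w: "w \<in> L - {0}" and "u \<in> cball z r" for u w
  proof (cases "norm w \<le> 2 * R")
    case True
    have "w \<notin> cball z \<epsilon>" using \<epsilon> w by blast
    then have "norm (w - z) > \<epsilon>" by (simp add: dist_norm norm_minus_commute)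
    moreover have "norm (u - z) \<le> r" using that by (simp add: dist_norm norm_minus_commute)
    moreover have "norm (w - z) \<le> norm (u - w) + norm (u - z)"
      using norm_triangle_ineq4[of "u - z" "u - w"] by simp
    ultimately have "norm (u - w) \<ge> r" by (simp add: r_def)
    moreover have "\<delta> * norm w \<le> r / (2 * R) * (2 * R)"
      using True \<delta> R r by (intro mult_mono) auto
    ultimately show ?thesis using R by simp
  next
    case False
    have "\<delta> * norm w \<le> 1/2 * norm w" using \<delta> by (intro mult_right_mono) auto
    also have "\<dots> \<le> norm w - R" using False by simp
    also have "\<dots> \<le> norm (u - w)"
      using u[OF that(2)] norm_triangle_ineq2[of w u] by (simp add: norm_minus_commute)
    finally show ?thesis .
  qed
  let ?M = "\<lambda>w. R\<^sup>2 / \<delta> * (1 / norm w ^ 3)"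
  have "norm (1 / (u - w) + 1 / w + u / w^2) \<le> ?M w" if w: "w \<in> L - {0}" and uu: "u \<in> cball z r" for u w
  proof -
    have w0: "w \<noteq> 0" using w by simp
    have pos: "\<delta> * norm w > 0" using \<delta> w0 by simp
    then have uw: "u - w \<noteq> 0" using far[OF w uu] by auto
    have "1 / (u - w) + 1 / w + u / w^2 = u\<^sup>2 / ((u - w) * w\<^sup>2)"
      using w0 uw by (simp add: field_simps power2_eq_square)
    also have "norm \<dots> = (norm u)\<^sup>2 / (norm (u - w) * (norm w)\<^sup>2)"
      by (simp add: norm_divide norm_mult norm_power)
    also have "\<dots> \<le> R\<^sup>2 / (\<delta> * norm w * (norm w)\<^sup>2)"
      using far[OF w uu] u[OF uu] pos w0 \<delta>(1)
      by (intro frac_le power_mono mult_right_mono mult_pos_pos) auto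
    also have "\<dots> = ?M w" by (simp add: power2_eq_square power3_eq_cube)
    finally show ?thesis .
  qed
  moreover have "?M summable_on (L - {0})"
    by (intro summable_on_cmult_right summable_lattice)
  moreover have "cball z r \<subseteq> - (L - {0})"
    using \<epsilon>(2) subset_cball[of r \<epsilon> z] r by force
  ultimately show ?thesis using r(1) by blast
qed

lemma zeta_reg_holomorphic: "zeta_reg holomorphic_on - (L - {0})"
  and zeta_reg_has_sum_derivs: "z \<in> - (L - {0}) \<Longrightarrow>
    ((\<lambda>w. (deriv ^^ m) (\<lambda>z. 1 / (z - w) + 1 / w + z / w^2) z) has_sum (deriv ^^ m) zeta_reg z) (L - {0})"
proof -
  have hol: "(\<lambda>z. 1 / (z - w) + 1 / w + z / w^2) holomorphic_on - (L - {0})" if "w \<in> L - {0}" for w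
    using that by (intro holomorphic_intros) auto
  note sum = holomorphic_infsum[OF open_compl_lattice(2) hol zeta_reg_majorant]
  show "zeta_reg holomorphic_on - (L - {0})"
    unfolding zeta_reg_def by (rule sum(1))
  show "((\<lambda>w. (deriv ^^ m) (\<lambda>z. 1 / (z - w) + 1 / w + z / w^2) z) has_sum (deriv ^^ m) zeta_reg z) (L - {0})"
    if "z \<in> - (L - {0})"
    unfolding zeta_reg_def by (rule sum(2)[OF _ _ that])
qed

lemma deriv_zeta_term:
  fixes z w :: complex
  assumes "z \<noteq> w" "w \<noteq> 0"
  shows "deriv (\<lambda>z. 1 / (z - w) + 1 / w + z / w^2) z = - (1 / (z - w)^2 - 1 / w^2)"
    and "deriv (deriv (\<lambda>z. 1 / (z - w) + 1 / w + z / w^2)) z = 2 / (z - w)^3"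
proof -
  have d: "deriv (\<lambda>z. 1 / (z - w) + 1 / w + z / w^2) u = - (1 / (u - w)^2 - 1 / w^2)" if "u \<noteq> w" for u
    using that assms(2)
    by (intro DERIV_imp_deriv) (auto intro!: derivative_eq_intros simp: power2_eq_square)
  show "deriv (\<lambda>z. 1 / (z - w) + 1 / w + z / w^2) z = - (1 / (z - w)^2 - 1 / w^2)"
    by (rule d[OF assms(1)])
  have "\<forall>\<^sub>F u in nhds z. deriv (\<lambda>z. 1 / (z - w) + 1 / w + z / w^2) u = - (1 / (u - w)^2 - 1 / w^2)"
    using t1_space_nhds[OF assms(1)] by eventually_elim (rule d)
  then have "deriv (deriv (\<lambda>z. 1 / (z - w) + 1 / w + z / w^2)) z = deriv (\<lambda>u. - (1 / (u - w)^2 - 1 / w^2)) z"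
    by (rule deriv_cong_ev) simp
  also have "\<dots> = 2 / (z - w)^3"
  proof (rule DERIV_imp_deriv)
    have v: "z - w \<noteq> 0" using assms by simp
    have "((\<lambda>u. - (1 / (u - w)^2 - 1 / w^2)) has_field_derivative - ((2 * w - 2 * z) / ((z - w)^2 * (z - w)^2))) (at z)"
      using v by (auto intro!: derivative_eq_intros simp: power2_eq_square)
    also have "- ((2 * w - 2 * z) / ((z - w)^2 * (z - w)^2)) = (2 * (z - w)) / ((z - w)^2 * (z - w)^2)"
      by (subst minus_divide_left) (simp add: algebra_simps)
    also have "\<dots> = 2 / (z - w)^3"
    proof -
      have "(2 * x) / (x^2 * x^2) = 2 / x^3" if "x \<noteq> 0" for x :: complex
        using that by (simp add: power2_eq_square power3_eq_cube)
      from this[OF v] show ?thesis .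
    qed
    finally show "((\<lambda>u. - (1 / (u - w)^2 - 1 / w^2)) has_field_derivative 2 / (z - w)^3) (at z)" .
  qed
  finally show "deriv (deriv (\<lambda>z. 1 / (z - w) + 1 / w + z / w^2)) z = 2 / (z - w)^3" .
qed

lemma zeta_conv_reg: "zeta z = 1 / z + zeta_reg z"
  by (simp add: weierstrass_zeta_def zeta_reg_def)

lemma wp_conv_reg:
  assumes "z \<in> - (L - {0})"
  shows "wp z = 1 / z\<^sup>2 - deriv zeta_reg z"
proof -
  have "((\<lambda>w. deriv (\<lambda>z. 1 / (z - w) + 1 / w + z / w^2) z) has_sum deriv zeta_reg z) (L - {0})"
    using zeta_reg_has_sum_derivs[OF assms, of 1] by simp
  then have "((\<lambda>w. - (1 / (z - w)^2 - 1 / w^2)) has_sum deriv zeta_reg z) (L - {0})"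
    by (rule has_sum_cong[THEN iffD1, rotated]) (use assms in \<open>auto simp del: minus_diff_eq intro!: deriv_zeta_term(1)\<close>)
  then have "((\<lambda>w. 1 / (z - w)^2 - 1 / w^2) has_sum (- deriv zeta_reg z)) (L - {0})"
    using has_sum_uminus[of "\<lambda>w. 1 / (z - w)^2 - 1 / w^2"] by simp
  then show ?thesis by (simp add: weierstrass_wp_def infsumI)
qed

lemma deriv2_zeta_reg:
  assumes "z \<in> - (L - {0})"
  shows "((\<lambda>w. 2 / (z - w)^3) has_sum deriv (deriv zeta_reg) z) (L - {0})"
proof -
  have "((\<lambda>w. deriv (deriv (\<lambda>z. 1 / (z - w) + 1 / w + z / w^2)) z) has_sum deriv (deriv zeta_reg) z) (L - {0})"
    using zeta_reg_has_sum_derivs[OF assms, of 2] by (simp add: numeral_2_eq_2)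
  then show ?thesis
    by (rule has_sum_cong[THEN iffD1, rotated]) (use assms in \<open>auto intro!: deriv_zeta_term(2)\<close>)
qed

lemma bij_uminus_lattice: "bij_betw uminus (L - {0}) (L - {0})"
  by (rule bij_betwI[of _ _ _ uminus]) auto

text \<open>Because of these values, only quantities at \<open>2 * p\<close> enter the logarithm
  condition at \<open>p\<close>. The second derivative vanishes since \<open>w \<mapsto> - w\<close>
  reverses the sign of its series.\<close>

lemma zeta_reg_at_0:
  "zeta_reg 0 = 0" "deriv zeta_reg 0 = 0" "deriv (deriv zeta_reg) 0 = 0"
proof -
  show "zeta_reg 0 = 0" by (simp add: zeta_reg_def)
  \<comment> \<open>At the origin \<open>1 / 0 = 0\<close> removes the polar term, and each summand
    of \<open>wp 0\<close> cancels.\<close>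
  show "deriv zeta_reg 0 = 0" using wp_conv_reg[of 0] by (simp add: weierstrass_wp_def)
  have "deriv (deriv zeta_reg) 0 = (\<Sum>\<^sub>\<infinity>w\<in>L - {0}. 2 / (0 - w)^3)"
    using deriv2_zeta_reg[of 0] by (simp add: infsumI)
  also have "\<dots> = (\<Sum>\<^sub>\<infinity>w\<in>L - {0}. 2 / (0 - (- w))^3)"
    by (rule infsum_reindex_bij_betw[OF bij_uminus_lattice, symmetric])
  also have "\<dots> = (\<Sum>\<^sub>\<infinity>w\<in>L - {0}. - (2 / (0 - w)^3))" by simp
  also have "\<dots> = - (\<Sum>\<^sub>\<infinity>w\<in>L - {0}. 2 / (0 - w)^3)" by (rule infsum_uminus)
  also have "\<dots> = - deriv (deriv zeta_reg) 0"
    using deriv2_zeta_reg[of 0] by (simp add: infsumI)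
  finally show "deriv (deriv zeta_reg) 0 = 0" by simp
qed

lemma zeta_minus: "zeta (- z) = - zeta z"
proof -
  have "zeta_reg (- z) = (\<Sum>\<^sub>\<infinity>w\<in>L - {0}. 1 / (- z - (- w)) + 1 / (- w) + (- z) / (- w)^2)"
    unfolding zeta_reg_def by (rule infsum_reindex_bij_betw[OF bij_uminus_lattice, symmetric])
  also have "\<dots> = (\<Sum>\<^sub>\<infinity>w\<in>L - {0}. - (1 / (z - w) + 1 / w + z / w^2))"
  proof (rule infsum_cong)
    fix w
    have "1 / (- z - (- w)) = - (1 / (z - w))"
      using minus_divide_right[of 1 "z - w"] by simp
    then show "1 / (- z - (- w)) + 1 / (- w) + (- z) / (- w)^2 = - (1 / (z - w) + 1 / w + z / w^2)"
      by simp
  qed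
  also have "\<dots> = - zeta_reg z" unfolding zeta_reg_def by (rule infsum_uminus)
  finally show ?thesis by (simp add: zeta_conv_reg)
qed

lemma wp_minus: "wp (- z) = wp z"
proof -
  have "(\<Sum>\<^sub>\<infinity>w\<in>L - {0}. 1 / (- z - w)^2 - 1 / w^2) = (\<Sum>\<^sub>\<infinity>w\<in>L - {0}. 1 / (- z - (- w))^2 - 1 / (- w)^2)"
    by (rule infsum_reindex_bij_betw[OF bij_uminus_lattice, symmetric])
  also have "\<dots> = (\<Sum>\<^sub>\<infinity>w\<in>L - {0}. 1 / (z - w)^2 - 1 / w^2)"
    by (rule infsum_cong) (simp add: power2_commute)
  finally show ?thesis by (simp add: weierstrass_wp_def)
qed

lemma zeta_has_deriv: "z \<notin> L \<Longrightarrow> (zeta has_field_derivative - wp z) (at z)"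
proof -
  assume z: "z \<notin> L"
  then have z': "z \<in> - (L - {0})" "z \<noteq> 0" using zero_in_lattice[of \<tau>] by auto
  have "((\<lambda>z. 1 / z + zeta_reg z) has_field_derivative - 1 / (z * z) + deriv zeta_reg z) (at z)"
    using z' holomorphic_derivI[OF zeta_reg_holomorphic open_compl_lattice(2) z'(1)]
    by (auto intro!: derivative_eq_intros)
  then show ?thesis
    unfolding wp_conv_reg[OF z'(1)] zeta_conv_reg[abs_def] by (simp add: power2_eq_square)
qed

text \<open>Absorbing \<open>- 2 / z ^ 3\<close> as the term \<open>w = 0\<close> produces a sum
  over the full lattice, for which translation by a period is a mere reindexing.\<close>

lemma wp_has_deriv:
  "z \<notin> L \<Longrightarrow> (wp has_field_derivative - 2 * (\<Sum>\<^sub>\<infinity>w\<in>L. 1 / (z - w)^3)) (at z)"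
proof -
  assume z: "z \<notin> L"
  then have z': "z \<in> - (L - {0})" "z \<noteq> 0" using zero_in_lattice[of \<tau>] by auto
  have d: "((\<lambda>z. 1 / z\<^sup>2 - deriv zeta_reg z) has_field_derivative - 2 / z^3 - deriv (deriv zeta_reg) z) (at z)"
  proof (rule DERIV_diff)
    show "((\<lambda>z. 1 / z\<^sup>2) has_field_derivative - 2 / z^3) (at z)"
      using z'(2) by (auto intro!: derivative_eq_intros simp: power2_eq_square power3_eq_cube field_simps)
    show "(deriv zeta_reg has_field_derivative deriv (deriv zeta_reg) z) (at z)"
      by (rule holomorphic_derivI[OF holomorphic_deriv[OF zeta_reg_holomorphic open_compl_lattice(2)] open_compl_lattice(2) z'(1)])
  qed
  have "((\<lambda>w. 2 * (1 / (z - w)^3)) has_sum (2 / z^3 + deriv (deriv zeta_reg) z)) (insert 0 (L - {0}))"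
    using has_sum_insert[OF _ deriv2_zeta_reg[OF z'(1)], of 0] by simp
  then have "2 * (\<Sum>\<^sub>\<infinity>w\<in>L. 1 / (z - w)^3) = 2 / z^3 + deriv (deriv zeta_reg) z"
    by (subst infsum_cmult_right'[symmetric]) (simp add: insert_absorb infsumI)
  then have e: "- 2 * (\<Sum>\<^sub>\<infinity>w\<in>L. 1 / (z - w)^3) = - 2 / z^3 - deriv (deriv zeta_reg) z" by simp
  show ?thesis
    unfolding e
    by (rule has_field_derivative_transform_within_open[OF d open_compl_lattice(2) z'(1)])
       (simp add: wp_conv_reg)
qed

lemma wp_holomorphic: "wp holomorphic_on - L" and zeta_holomorphic: "zeta holomorphic_on - L"
  using wp_has_deriv zeta_has_deriv holomorphic_on_open[OF open_compl_lattice(1)] by blast+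

text \<open>The difference of \<open>f\<close> and its translate has derivative zero on the
  complement of the lattice, which is connected.\<close>

lemma constant_difference:
  assumes \<omega>: "\<omega> \<in> L"
    and d: "\<And>z. z \<notin> L \<Longrightarrow> (f has_field_derivative f' z) (at z)"
    and f': "\<And>z. z \<notin> L \<Longrightarrow> f' (z + \<omega>) = f' z"
  shows "\<exists>c. \<forall>z. z \<notin> L \<longrightarrow> f (z + \<omega>) = f z + c"
proof -
  have "((\<lambda>z. f (z + \<omega>) - f z) has_field_derivative 0) (at z)" if z: "z \<in> - L" for z
  proof -
    have "(f has_field_derivative f' (z + \<omega>)) (at (z + \<omega>))"
      using z by (intro d) (simp add: lattice_add_iff[OF \<omega>])
    then have "((\<lambda>z. f (z + \<omega>)) has_field_derivative f' (z + \<omega>)) (at z)"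
      by (simp add: DERIV_shift)
    from DERIV_diff[OF this d] z f' show ?thesis by simp
  qed
  moreover from this have "continuous_on (- L) (\<lambda>z. f (z + \<omega>) - f z)"
    by (intro continuous_at_imp_continuous_on) (auto intro: DERIV_isCont)
  ultimately obtain c where "\<And>z. z \<in> - L \<Longrightarrow> f (z + \<omega>) - f z = c"
    using DERIV_zero_connected_constant[OF connected_compl_lattice open_compl_lattice(1) finite.emptyI, of "\<lambda>z. f (z + \<omega>) - f z"]
    by auto
  then have "\<forall>z. z \<notin> L \<longrightarrow> f (z + \<omega>) = f z + c" by (auto simp: algebra_simps)
  then show ?thesis ..
qed

lemma wp_periodic:
  assumes "\<omega> \<in> L" "z \<notin> L"
  shows "wp (z + \<omega>) = wp z"
proof -
  \<comment> \<open>The constant is read off at \<open>- (\<omega> / 2)\<close>, which is translated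
    to \<open>\<omega> / 2\<close>, where \<open>wp\<close> takes the same value by evenness. This
    asks for \<open>\<omega> / 2\<close> off the lattice, so general periods are reached from
    \<open>1\<close> and \<open>\<tau>\<close> by iteration.\<close>
  have half: "wp (z + \<omega>) = wp z" if \<omega>: "\<omega> \<in> L" "\<omega> / 2 \<notin> L" and z: "z \<notin> L" for \<omega> z
  proof -
    have per: "- 2 * (\<Sum>\<^sub>\<infinity>w\<in>L. 1 / (z + \<omega> - w)^3) = - 2 * (\<Sum>\<^sub>\<infinity>w\<in>L. 1 / (z - w)^3)" for z
    proof -
      have "bij_betw (\<lambda>w. w + \<omega>) L L"
        by (rule bij_betwI[of _ _ _ "\<lambda>w. w - \<omega>"]) (use \<omega> in \<open>auto intro: lattice_add lattice_diff\<close>)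
      from infsum_reindex_bij_betw[OF this, of "\<lambda>w. 1 / (z + \<omega> - w)^3"]
      show ?thesis by simp
    qed
    obtain c where c: "\<And>z. z \<notin> L \<Longrightarrow> wp (z + \<omega>) = wp z + c"
      using constant_difference[OF \<omega>(1) wp_has_deriv per] by auto
    have "wp (\<omega> / 2) = wp (- (\<omega> / 2)) + c"
      using c[of "- (\<omega> / 2)"] \<omega>(2) by simp
    then have "c = 0" by (simp add: wp_minus)
    with c z show ?thesis by simp
  qed
  have nat: "wp (z + of_nat n * \<omega>) = wp z" if \<omega>: "\<omega> \<in> L" "\<omega> / 2 \<notin> L" and z: "z \<notin> L" for \<omega> z n
  proof (induction n)
    case (Suc n)
    have "of_nat n * \<omega> \<in> L" for n
    proof (induction n)
      case (Suc n)
      then show ?case using lattice_add[OF Suc \<omega>(1)] by (simp add: algebra_simps)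
    qed auto
    then have "z + of_nat n * \<omega> \<notin> L" using z by (simp add: lattice_add_iff)
    from half[OF \<omega> this] Suc show ?case by (simp add: algebra_simps)
  qed simp
  have int: "wp (z + of_int n * \<omega>) = wp z" if \<omega>: "\<omega> \<in> L" "\<omega> / 2 \<notin> L" and z: "z \<notin> L" for \<omega> z n
  proof (cases n rule: int_cases2)
    case (nonneg m)
    then show ?thesis using nat[OF \<omega> z] by simp
  next
    case (nonpos m)
    have "wp (z + of_nat m * (- \<omega>)) = wp z"
      by (rule nat) (use \<omega> z lattice_uminus_iff[of "\<omega> / 2"] in auto)
    then show ?thesis by (simp add: nonpos)
  qed
  obtain m n :: int where w: "\<omega> = of_int m + of_int n * \<tau>" using assms by (auto simp: lattice_def)
  have "of_int m * 1 \<in> L"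
    unfolding lattice_def by (rule CollectI, rule exI[of _ m], rule exI[of _ 0]) simp
  then have "z + of_int m * 1 \<notin> L" using assms(2) by (subst lattice_add_iff)
  then have "wp (z + of_int m * 1 + of_int n * \<tau>) = wp (z + of_int m * 1)"
    by (intro int) (auto simp: half_period_notin_lattice)
  also have "\<dots> = wp z" by (intro int) (use assms(2) half_period_notin_lattice in auto)
  finally show ?thesis by (simp add: w algebra_simps)
qed

lemma zeta_quasi_periodic:
  assumes "\<omega> \<in> L"
  shows "\<exists>\<eta>. \<forall>z. z \<notin> L \<longrightarrow> zeta (z + \<omega>) = zeta z + \<eta>"
  by (rule constant_difference[OF assms zeta_has_deriv]) (use wp_periodic[OF assms] in auto)

end

section \<open>The generalized Lame equation\<close>

text \<open>\<open>two_p\<close> keeps the poles at \<open>p\<close> and \<open>- p\<close> apart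
  modulo the lattice, so that only one of the two \<open>wp\<close> terms is singular at each
  singular point.\<close>

locale lame = complex_torus +
  fixes p :: complex
  assumes two_p: "2 * p \<notin> L"
begin

abbreviation "S \<equiv> lame_singular \<tau> p"
abbreviation "Q \<equiv> lame_potential \<tau> p"

lemma regular_iff: "z \<notin> S \<longleftrightarrow> z + p \<notin> L \<and> z - p \<notin> L"
  by (simp add: lame_singular_def)

lemma p_singular: "p \<in> S"
  by (simp add: lame_singular_def)

lemma singular_add_iff: "c \<in> L \<Longrightarrow> z + c \<in> S \<longleftrightarrow> z \<in> S"
  using lattice_add_iff[of c \<tau> "z + p"] lattice_add_iff[of c \<tau> "z - p"]
  by (simp add: lame_singular_def algebra_simps)

lemma singular_uminus_iff: "- z \<in> S \<longleftrightarrow> z \<in> S"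
proof -
  have "- z + p = - (z - p)" "- z - p = - (z + p)" by simp_all
  then show ?thesis unfolding lame_singular_def mem_Collect_eq by (auto simp only: lattice_uminus_iff)
qed

lemma singular_not_islimpt: "\<not> z islimpt S"
proof -
  let ?F = "{w \<in> L. norm w \<le> norm z + norm p + 1}"
  have "S \<inter> ball z 1 \<subseteq> (\<lambda>w. w - p) ` ?F \<union> (\<lambda>w. w + p) ` ?F"
  proof
    fix s assume s: "s \<in> S \<inter> ball z 1"
    then have ns: "norm s \<le> norm z + 1"
      using norm_triangle_ineq[of z "s - z"] by (simp add: dist_norm norm_minus_commute)
    from s consider "s + p \<in> L" | "s - p \<in> L" by (auto simp: lame_singular_def)
    then show "s \<in> (\<lambda>w. w - p) ` ?F \<union> (\<lambda>w. w + p) ` ?F"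
    proof cases
      case 1
      then have "s + p \<in> ?F" using ns norm_triangle_ineq[of s p] by simp
      then show ?thesis by (intro UnI1 image_eqI[of _ _ "s + p"]) auto
    next
      case 2
      then have "s - p \<in> ?F" using ns norm_triangle_ineq4[of s p] by simp
      then show ?thesis by (intro UnI2 image_eqI[of _ _ "s - p"]) auto
    qed
  qed
  then have "finite (S \<inter> ball z 1)"
    using finite_lattice_ball finite_subset by blast
  then show ?thesis unfolding islimpt_eq_infinite_ball by (metis zero_less_one)
qed

lemma potential_holomorphic: "Q A holomorphic_on - S"
proof -
  have 1: "(\<lambda>z. f (z + p)) holomorphic_on - S" "(\<lambda>z. f (z - p)) holomorphic_on - S"
    if "f holomorphic_on - L" for f
  proof -
    have "f \<circ> (\<lambda>z. z + p) holomorphic_on - S"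
      by (rule holomorphic_on_compose_gen[OF _ that]) (auto intro!: holomorphic_intros simp: regular_iff)
    then show "(\<lambda>z. f (z + p)) holomorphic_on - S" by (simp add: o_def)
    have "f \<circ> (\<lambda>z. z - p) holomorphic_on - S"
      by (rule holomorphic_on_compose_gen[OF _ that]) (auto intro!: holomorphic_intros simp: regular_iff)
    then show "(\<lambda>z. f (z - p)) holomorphic_on - S" by (simp add: o_def)
  qed
  show ?thesis
    unfolding lame_potential_def[abs_def]
    by (intro holomorphic_intros 1 wp_holomorphic zeta_holomorphic)
qed

sublocale singular_ode "Q A" S for A
  by unfold_locales (use singular_not_islimpt potential_holomorphic in auto)

text \<open>Both \<open>zeta\<close> values gain the same constant, which cancels in their
  difference.\<close>

lemma potential_periodic:
  assumes "\<omega> \<in> L" "z \<notin> S"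
  shows "Q A (z + \<omega>) = Q A z"
proof -
  obtain \<eta> where \<eta>: "\<And>z. z \<notin> L \<Longrightarrow> zeta (z + \<omega>) = zeta z + \<eta>"
    using zeta_quasi_periodic[OF assms(1)] by blast
  have z: "z + p \<notin> L" "z - p \<notin> L" using assms(2) by (auto simp: regular_iff)
  have "z + \<omega> + p = z + p + \<omega>" "z + \<omega> - p = z - p + \<omega>" by simp_all
  then show ?thesis
    using \<eta>[OF z(1)] \<eta>[OF z(2)] wp_periodic[OF assms(1) z(1)] wp_periodic[OF assms(1) z(2)]
    by (simp only: lame_potential_def) simp
qed

lemma potential_even: "Q A (- z) = Q A z"
proof -
  have "- z + p = - (z - p)" "- z - p = - (z + p)" by simp_all
  then have "wp (- z + p) = wp (z - p)" "wp (- z - p) = wp (z + p)"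
    "zeta (- z + p) = - zeta (z - p)" "zeta (- z - p) = - zeta (z + p)"
    by (simp_all only: wp_minus zeta_minus)
  then show ?thesis by (simp only: lame_potential_def) simp
qed

lemma symmetry:
  assumes "e = 1 \<or> e = - 1" "c \<in> L"
  shows "e * z + c \<in> S \<longleftrightarrow> z \<in> S" "z \<notin> S \<Longrightarrow> Q A (e * z + c) = Q A z"
  using assms singular_uminus_iff[of z] potential_periodic[OF assms(2), of "e * z" A]
  by (auto simp: singular_add_iff potential_even)

text \<open>Such maps carry every singular point to \<open>p\<close>, so the local analysis is done
  there only. The derivative is prescribed as \<open>e * b\<close> because the chain rule multiplies
  it by \<open>e\<close> once more.\<close>

lemma solvable_symmetry:
  assumes s: "ode_solvable (Q A) S U" and U: "open U" and e: "e = 1 \<or> e = - 1" and c: "c \<in> L"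
    and V: "open V" "\<And>z. z \<in> V \<Longrightarrow> e * z + c \<in> U"
  shows "ode_solvable (Q A) S V"
  unfolding ode_solvable_def
proof (intro ballI allI)
  fix z a b assume z: "z \<in> V - S"
  then have "e * z + c \<in> U - S" using V symmetry(1)[OF e c] by auto
  then obtain y where y: "ode_solution (Q A) S U y" "y (e * z + c) = a" "deriv y (e * z + c) = e * b"
    using s unfolding ode_solvable_def by blast
  have e2: "e\<^sup>2 = 1" using e by auto
  note sol = ode_solution_compose_affine[OF y(1) open_diff[OF U] e2 V open_diff[OF V(1)],
      where R = "Q A"]
  have "ode_solution (Q A) S V (\<lambda>z. y (e * z + c))"
    by (rule sol) (use symmetry[OF e c] in auto)
  moreover have "deriv (\<lambda>z. y (e * z + c)) z = e * deriv y (e * z + c)"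
    by (rule sol) (use symmetry[OF e c] z in auto)
  ultimately show "\<exists>y. ode_solution (Q A) S V y \<and> y z = a \<and> deriv y z = b"
    using y e2 by (intro exI[of _ "\<lambda>z. y (e * z + c)"]) (simp add: power2_eq_square flip: mult.assoc)
qed

text \<open>Origin of \<open>lame_B\<close>: with \<open>a = - A\<close>, the regular part at
  \<open>p\<close> has value \<open>2 * wp (2 * p) + A * zeta (2 * p) + B\<close> and derivative
  \<open>2 * deriv wp (2 * p) - A * wp (2 * p)\<close>. The logarithm condition is linear in
  \<open>B\<close> with coefficient \<open>A\<close>, and solving it gives
  \<open>lame_B\<close>.\<close>

lemma solvable_near_p:
  assumes A: "A \<noteq> 0" and \<delta>: "0 < r" "r < \<delta>" "ball p \<delta> \<inter> S \<subseteq> {p}"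
  shows "ode_solvable (Q A) S (ball p r)"
proof -
  let ?B = "lame_B \<tau> p A"
  let ?R = "\<lambda>z. 2 * (wp (z + p) - deriv zeta_reg (z - p)) + A * (zeta (z + p) - zeta_reg (z - p)) + ?B"
  have mem: "z + p \<notin> L" "z - p \<in> - (L - {0})" if "z \<in> ball p \<delta>" for z
  proof -
    show "z + p \<notin> L"
    proof (cases "z = p")
      case False
      then show ?thesis using that \<delta>(3) regular_iff[of z] by blast
    qed (use two_p in \<open>simp flip: mult_2\<close>)
    show "z - p \<in> - (L - {0})"
    proof (cases "z = p")
      case False
      then show ?thesis using that \<delta>(3) regular_iff[of z] by blast
    qed auto
  qed
  note dreg = holomorphic_derivI[OF zeta_reg_holomorphic open_compl_lattice(2)]
  note dreg2 = holomorphic_derivI[OF holomorphic_deriv[OF zeta_reg_holomorphic open_compl_lattice(2)]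
      open_compl_lattice(2)]
  note dwp = holomorphic_derivI[OF wp_holomorphic open_compl_lattice(1)]
  have shift: "((\<lambda>z. f (z + c)) has_field_derivative f') (at z)"
    if "(f has_field_derivative f') (at (z + c))" for f f' and z c :: complex
    using that by (simp add: DERIV_shift)
  have dR: "(?R has_field_derivative 2 * (deriv wp (z + p) - deriv (deriv zeta_reg) (z - p))
      + A * (- wp (z + p) - deriv zeta_reg (z - p)) + 0) (at z)" if z: "z \<in> ball p \<delta>" for z
    using mem[OF z] shift[of wp _ z p] shift[of zeta _ z p] shift[of zeta_reg _ z "- p"]
      shift[of "deriv zeta_reg" _ z "- p"] dreg[of "z - p"] dreg2[of "z - p"] dwp[of "z + p"]
      zeta_has_deriv[of "z + p"]
    by (intro DERIV_add DERIV_cmult DERIV_diff DERIV_const) auto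
  show ?thesis
  proof (rule solvable_apparent[where W = "ball p \<delta>" and R = ?R and a = "- A"])
    show "p \<in> S" by (rule p_singular)
    show "cball p r \<inter> S \<subseteq> {p}" using \<delta> by (auto simp: subset_iff)
    show "cball p r \<subseteq> ball p \<delta>" using \<delta> by auto
    show "?R holomorphic_on ball p \<delta>"
      using dR holomorphic_on_open[OF open_ball] by blast
    show "Q A z = 2 / (z - p)\<^sup>2 + - A / (z - p) + ?R z" if "z \<in> ball p r - {p}" for z
    proof -
      have "z \<in> ball p \<delta>" using that \<delta> by auto
      from mem[OF this] show ?thesis
        unfolding lame_potential_def zeta_conv_reg[of "z - p"]
        by (simp add: wp_conv_reg[of "z - p"] right_diff_distrib distrib_left)
    qed
    have p\<delta>: "p \<in> ball p \<delta>" using \<delta> by simp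
    have "deriv ?R p = 2 * deriv wp (2 * p) - A * wp (2 * p)"
      using DERIV_imp_deriv[OF dR[OF p\<delta>]] by (simp add: zeta_reg_at_0 flip: mult_2)
    moreover have "?R p = 2 * wp (2 * p) + A * zeta (2 * p) + ?B"
      by (simp add: zeta_reg_at_0 flip: mult_2)
    ultimately show "(- A) ^ 3 / 4 - (- A) * ?R p + deriv ?R p = 0"
      using A by (simp only:) (simp add: lame_B_def field_simps power2_eq_square power3_eq_cube)
  qed (use \<delta> in auto)
qed

lemma solvable:
  assumes A: "A \<noteq> 0"
  shows "ode_solvable (Q A) S UNIV"
proof -
  obtain \<delta> where \<delta>: "\<delta> > 0" "ball p \<delta> \<inter> S \<subseteq> {p}"
  proof -
    from singular_not_islimpt[of p] obtain e where "e > 0" "\<And>x. x \<in> S \<Longrightarrow> x \<noteq> p \<Longrightarrow> \<not> dist x p < e"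
      unfolding islimpt_approachable by blast
    moreover from this have "ball p e \<inter> S \<subseteq> {p}" by (metis IntE dist_commute mem_ball singletonI subsetI)
    ultimately show ?thesis using that by blast
  qed
  define r where "r = \<delta> / 2"
  have r: "0 < r" "r < \<delta>" using \<delta> by (auto simp: r_def)
  have near: "ode_solvable (Q A) S (ball s r)" if s: "s \<in> S" for s
  proof -
    \<comment> \<open>A singular point is congruent to \<open>p\<close> or \<open>- p\<close>;
      \<open>e\<close> is this sign, and the constant \<open>p - e * s\<close> then sends
      \<open>s\<close> to \<open>p\<close>.\<close>
    obtain e where e: "e = 1 \<or> e = - 1" "p - e * s \<in> L"
    proof (cases "s + p \<in> L")
      case True
      then show ?thesis using that[of "- 1"] by (simp add: add.commute)
    next
      case False
      then have "s - p \<in> L" using s regular_iff by blast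
      then show ?thesis using that[of 1] lattice_uminus_iff[of "s - p" \<tau>] by simp
    qed
    have "e * z + (p - e * s) \<in> ball p r" if "z \<in> ball s r" for z
    proof -
      have "norm (e * (z - s)) < r" using that e(1) by (auto simp: dist_norm norm_minus_commute)
      then show ?thesis by (simp add: dist_norm norm_minus_commute algebra_simps)
    qed
    then show ?thesis
      by (intro solvable_symmetry[OF solvable_near_p[OF A r \<delta>(2)] open_ball e open_ball])
  qed
  show ?thesis
  \<comment> \<open>A disc of radius \<open>r / 4\<close> either has its centre within
    \<open>r / 2\<close> of a singular point, and then lies in the disc of radius \<open>r\<close>
    about it, or it avoids \<open>S\<close>.\<close>
  proof (rule solvable_UNIV[of "r / 4"])
    fix c
    show "ode_solvable (Q A) S (ball c (r / 4))"
    proof (cases "\<exists>s\<in>S. dist c s < r / 2")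
      case True
      then obtain s where s: "s \<in> S" "dist c s < r / 2" by blast
      have "ball c (r / 4) \<subseteq> ball s r"
      proof
        fix z assume "z \<in> ball c (r / 4)"
        then show "z \<in> ball s r"
          using s(2) dist_triangle[of s z c] r by (simp add: dist_commute)
      qed
      then show ?thesis using near[OF s(1)] by (rule ode_solvable_subset[rotated])
    next
      case False
      then have "cball c (r / 4) \<inter> S = {}" using r by force
      then show ?thesis by (rule solvable_regular)
    qed
  qed (use r in auto)
qed

lemma lame_solution_iff: "lame_solution \<tau> p A y \<longleftrightarrow> ode_solution (Q A) S UNIV y"
  by (auto simp add: lame_solution_def ode_solution_def Compl_eq_Diff_UNIV)

text \<open>Justifies the \<open>THE\<close>: the pair normalized at \<open>z0\<close> is a basis
  with a monodromy matrix, and the matrix of any other basis is conjugate to it.\<close>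

lemma hill_discriminant_eq:
  assumes A: "A \<noteq> 0" and z0: "z0 \<notin> S" and \<omega>: "period \<tau> k \<in> L"
    and Y1: "ode_solution (Q A) S UNIV Y1" "Y1 z0 = 1" "deriv Y1 z0 = 0"
    and Y2: "ode_solution (Q A) S UNIV Y2" "Y2 z0 = 0" "deriv Y2 z0 = 1"
  shows "hill_discriminant \<tau> p k A = (Y1 (z0 + period \<tau> k) + deriv Y2 (z0 + period \<tau> k)) / 2"
proof -
  define \<omega> where "\<omega> = period \<tau> k"
  have \<omega>: "\<omega> \<in> L" using assms by (simp add: \<omega>_def)
  note op = open_diff[OF open_UNIV]
  have reg: "z + \<omega> \<notin> S" if "z \<notin> S" for z using that by (simp add: singular_add_iff \<omega>)
  have expand: "y z = y z0 * Y1 z + deriv y z0 * Y2 z"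
    and expand': "deriv y z = y z0 * deriv Y1 z + deriv y z0 * deriv Y2 z"
    if y: "ode_solution (Q A) S UNIV y" and z: "z \<notin> S" for y z
  proof -
    note lin = ode_solution_linear[OF Y1(1) Y2(1) op, where a = "y z0" and b = "deriv y z0"]
    have eq: "y z = y z0 * Y1 z + deriv y z0 * Y2 z" if "z \<notin> S" for z
      by (rule unique[OF open_UNIV connected_UNIV y lin(1)]) (use z0 that Y1 Y2 lin(2) in auto)
    from eq[OF z] show "y z = y z0 * Y1 z + deriv y z0 * Y2 z" .
    show "deriv y z = y z0 * deriv Y1 z + deriv y z0 * deriv Y2 z"
      using cong(2)[OF open_UNIV lin(1), of y z] lin(2)[of z] eq z by simp
  qed
  have shift: "ode_solution (Q A) S UNIV (\<lambda>z. y (z + \<omega>))"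
    "z \<notin> S \<Longrightarrow> deriv (\<lambda>z. y (z + \<omega>)) z = deriv y (z + \<omega>)"
    if y: "ode_solution (Q A) S UNIV y" for y z
    using ode_solution_compose_affine[OF y op, of 1 UNIV \<omega> S "Q A"]
    by (auto simp: op singular_add_iff \<omega> potential_periodic)
  define T where "T = Y1 (z0 + \<omega>) + deriv Y2 (z0 + \<omega>)"
  have basis: "lame_basis \<tau> p A Y1 Y2"
    unfolding lame_basis_def lame_solution_iff
  proof (intro conjI allI impI Y1 Y2)
    fix a b assume ab: "\<forall>z. z \<notin> S \<longrightarrow> a * Y1 z + b * Y2 z = 0"
    show "a = 0" using ab[rule_format, OF z0] Y1 Y2 by simp
    have "ode_solution (Q A) S UNIV (\<lambda>_. 0)"
      by (auto simp: ode_solution_def)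
    from cong(2)[OF open_UNIV this, of "\<lambda>z. a * Y1 z + b * Y2 z" z0]
    have "deriv (\<lambda>z. a * Y1 z + b * Y2 z) z0 = 0" using ab z0 by simp
    then show "b = 0"
      using ode_solution_linear(2)[OF Y1(1) Y2(1) op, where a = a and b = b, of z0] z0 Y1 Y2 by simp
  next
    fix y assume "ode_solution (Q A) S UNIV y"
    then show "\<exists>a b. \<forall>z. z \<notin> S \<longrightarrow> y z = a * Y1 z + b * Y2 z" using expand by blast
  qed
  \<comment> \<open>The rows are the Cauchy data at \<open>z0\<close> of the translated solutions,
    that is, their coefficients in the basis normalized there.\<close>
  define N :: "complex^2^2" where
    "N = vector [vector [Y1 (z0 + \<omega>), deriv Y1 (z0 + \<omega>)], vector [Y2 (z0 + \<omega>), deriv Y2 (z0 + \<omega>)]]"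
  have mono: "lame_monodromy \<tau> p \<omega> Y1 Y2 N"
    unfolding lame_monodromy_def
  proof (intro conjI allI impI)
    \<comment> \<open>The Wronskian is constant because the equation has no first-order term; its
      values at \<open>z0\<close> and \<open>z0 + \<omega>\<close> give the determinant.\<close>
    let ?W = "\<lambda>z. Y1 z * deriv Y2 z - deriv Y1 z * Y2 z"
    have W: "(?W has_field_derivative 0) (at z)" if "z \<in> UNIV - S" for z
    proof -
      note d = ode_solutionD[OF Y1(1) op that] ode_solutionD[OF Y2(1) op that]
      show ?thesis by (rule derivative_eq_intros d refl)+ simp
    qed
    moreover from this have "continuous_on (UNIV - S) ?W"
      by (intro continuous_at_imp_continuous_on) (auto intro: DERIV_isCont)
    ultimately obtain c where c: "\<And>z. z \<in> UNIV - S \<Longrightarrow> ?W z = c"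
      using DERIV_zero_connected_constant[OF connected_diff[OF open_UNIV connected_UNIV] op finite.emptyI, of ?W]
      by auto
    have "?W (z0 + \<omega>) = ?W z0" using c z0 reg[OF z0] by simp
    then show "det N = 1" by (simp add: N_def det_2 Y1 Y2)
    fix z assume z: "z \<notin> S"
    show "(vector [Y1 (z + \<omega>), Y2 (z + \<omega>)] :: complex^2) = N *v vector [Y1 z, Y2 z]"
      using expand[OF shift(1)[OF Y1(1)] z] expand[OF shift(1)[OF Y2(1)] z]
        shift(2)[OF Y1(1) z0] shift(2)[OF Y2(1) z0]
      by (simp add: vec_eq_iff forall_2 N_def matrix_vector_mult_def sum_2)
  qed
  have trN: "trace N = T" by (simp add: T_def N_def trace_def sum_2)
  have unique_trace: "trace M = T"
    if b: "lame_basis \<tau> p A y1 y2" and m: "lame_monodromy \<tau> p \<omega> y1 y2 M" for y1 y2 M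
  proof -
    have y: "ode_solution (Q A) S UNIV y1" "ode_solution (Q A) S UNIV y2"
      using b by (auto simp: lame_basis_def lame_solution_iff)
    have eq: "y1 (z + \<omega>) = M$1$1 * y1 z + M$1$2 * y2 z" "y2 (z + \<omega>) = M$2$1 * y1 z + M$2$2 * y2 z"
      if "z \<notin> S" for z
      using m that by (auto simp: lame_monodromy_def vec_eq_iff forall_2 matrix_vector_mult_def sum_2)
    note lin = ode_solution_linear[OF y op]
    have eq': "deriv y1 (z0 + \<omega>) = M$1$1 * deriv y1 z0 + M$1$2 * deriv y2 z0"
      "deriv y2 (z0 + \<omega>) = M$2$1 * deriv y1 z0 + M$2$2 * deriv y2 z0"
      using cong(2)[OF open_UNIV lin(1)[of "M$1$1" "M$1$2"], of "\<lambda>z. y1 (z + \<omega>)" z0]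
        cong(2)[OF open_UNIV lin(1)[of "M$2$1" "M$2$2"], of "\<lambda>z. y2 (z + \<omega>)" z0]
        lin(2)[of z0] shift(2)[OF y(1) z0] shift(2)[OF y(2) z0] eq z0
      by simp_all
    define D where "D = y1 z0 * deriv y2 z0 - deriv y1 z0 * y2 z0"
    \<comment> \<open>If the Wronskian \<open>D\<close> were zero, a nontrivial combination would
      have zero Cauchy data at \<open>z0\<close> and hence vanish.\<close>
    have "D \<noteq> 0"
    proof
      assume D0: "D = 0"
      have zero: "a = 0 \<and> b = 0"
        if "a * y1 z0 + b * y2 z0 = 0" "a * deriv y1 z0 + b * deriv y2 z0 = 0" for a b
      proof -
        have "\<forall>z. z \<notin> S \<longrightarrow> a * y1 z + b * y2 z = 0"
          using expand[OF lin(1)[of a b]] lin(2)[of z0 a b] that z0 by simp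
        with b show ?thesis unfolding lame_basis_def by blast
      qed
      have z: "y2 z0 = 0" "y1 z0 = 0"
        using zero[of "y2 z0" "- y1 z0"] D0 by (simp_all add: D_def algebra_simps)
      then have "deriv y2 z0 = 0" using zero[of "deriv y2 z0" "- deriv y1 z0"] by simp
      with zero[of 0 1] z show False by simp
    qed
    let ?n11 = "M$1$1" and ?n12 = "M$1$2" and ?n21 = "M$2$1" and ?n22 = "M$2$2"
    have e: "?n11 * y1 z0 + ?n12 * y2 z0 = y1 z0 * Y1 (z0 + \<omega>) + deriv y1 z0 * Y2 (z0 + \<omega>)"
      "?n11 * deriv y1 z0 + ?n12 * deriv y2 z0 = y1 z0 * deriv Y1 (z0 + \<omega>) + deriv y1 z0 * deriv Y2 (z0 + \<omega>)"
      "?n21 * y1 z0 + ?n22 * y2 z0 = y2 z0 * Y1 (z0 + \<omega>) + deriv y2 z0 * Y2 (z0 + \<omega>)"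
      "?n21 * deriv y1 z0 + ?n22 * deriv y2 z0 = y2 z0 * deriv Y1 (z0 + \<omega>) + deriv y2 z0 * deriv Y2 (z0 + \<omega>)"
      using expand[OF y(1) reg[OF z0]] expand[OF y(2) reg[OF z0]]
        expand'[OF y(1) reg[OF z0]] expand'[OF y(2) reg[OF z0]] eq[OF z0] eq' by simp_all
    \<comment> \<open>With \<open>W\<close> the matrix of Cauchy data of the basis at
      \<open>z0\<close>, the equations \<open>e\<close> say \<open>M W = W N\<close>. The right-hand
      side is the trace of \<open>M W\<close> times the adjugate of \<open>W\<close>, which avoids
      inverting \<open>W\<close>.\<close>
    have "D * (?n11 + ?n22) =
        deriv y2 z0 * (?n11 * y1 z0 + ?n12 * y2 z0) - y2 z0 * (?n11 * deriv y1 z0 + ?n12 * deriv y2 z0)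
      + y1 z0 * (?n21 * deriv y1 z0 + ?n22 * deriv y2 z0) - deriv y1 z0 * (?n21 * y1 z0 + ?n22 * y2 z0)"
      by (simp add: D_def algebra_simps)
    also have "\<dots> = D * T"
      unfolding e by (simp add: D_def T_def algebra_simps)
    finally show ?thesis using \<open>D \<noteq> 0\<close> by (simp add: trace_def sum_2)
  qed
  have "hill_discriminant \<tau> p k A = T / 2"
    unfolding hill_discriminant_def
  proof (rule the_equality)
    show "\<exists>y1 y2 N. lame_basis \<tau> p A y1 y2 \<and> lame_monodromy \<tau> p (period \<tau> k) y1 y2 N \<and> T / 2 = trace N / 2"
      using basis mono trN unfolding \<omega>_def by blast
  qed (use unique_trace in \<open>auto simp: \<omega>_def\<close>)
  then show ?thesis by (simp add: T_def \<omega>_def)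
qed

end

section \<open>Holomorphy of the Hill discriminant\<close>

context lame
begin

text \<open>Lines parallel to \<open>\<omega>\<close> are indexed by
  \<open>Im (z / \<omega>)\<close>, and the countable set \<open>S\<close> meets only countably many
  of them.\<close>

lemma regular_line:
  assumes "\<omega> \<noteq> 0"
  obtains z0 where "\<And>t. z0 + of_real t * \<omega> \<notin> S"
proof -
  have "countable ((\<lambda>s. Im (s / \<omega>)) ` S)" by (intro countable_image countable_S)
  then have "(\<lambda>s. Im (s / \<omega>)) ` S \<noteq> UNIV" using uncountable_UNIV_real by metis
  then obtain x where x: "x \<notin> (\<lambda>s. Im (s / \<omega>)) ` S" by blast
  have "\<i> * \<omega> * of_real x + of_real t * \<omega> \<notin> S" for t
  proof
    assume "\<i> * \<omega> * of_real x + of_real t * \<omega> \<in> S"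
    moreover have "Im ((\<i> * \<omega> * of_real x + of_real t * \<omega>) / \<omega>) = x"
      using assms by (simp add: add_divide_distrib)
    ultimately show False using x by force
  qed
  then show ?thesis by (rule that)
qed

text \<open>Thickening \<open>K\<close> by half its distance to \<open>S\<close> gives an open
  convex domain for the Picard iteration; the compact set around it bounds the potential.\<close>

lemma regular_strip:
  assumes K: "compact K" "convex K" "K \<inter> S = {}"
  obtains U C where "open U" "convex U" "compact C" "K \<subseteq> U" "U \<subseteq> C" "C \<inter> S = {}"
proof -
  obtain d where d: "d > 0" "\<And>x y. x \<in> K \<Longrightarrow> y \<in> S \<Longrightarrow> d \<le> dist x y"
    using separate_compact_closed[OF K(1) closed_S K(3)] by blast
  let ?U = "\<Union>x\<in>K. \<Union>y\<in>ball 0 (d/2). {x + y}"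
  let ?C = "{x + y | x y. x \<in> K \<and> y \<in> cball 0 (d/2)}"
  show ?thesis
  proof (rule that[of ?U ?C])
    show "open ?U" by (rule open_sums) simp
    show "convex ?U" by (rule convex_sums) (use K in auto)
    show "compact ?C" by (rule compact_sums) (use K in auto)
    show "K \<subseteq> ?U" using d(1) by force
    show "?U \<subseteq> ?C" by (auto, metis less_imp_le)
    show "?C \<inter> S = {}"
    proof (rule ccontr)
      assume "?C \<inter> S \<noteq> {}"
      then obtain x y where xy: "x \<in> K" "norm y \<le> d/2" "x + y \<in> S" by auto
      have "dist x (x + y) = norm y" by (simp add: dist_norm)
      with d(2)[OF xy(1,3)] xy(2) d(1) show False by simp
    qed
  qed
qed

text \<open>Together with \<open>pot1\<close> it displays the potential as a sum of three products
  of a function of \<open>z\<close> and one of \<open>A\<close>, as \<open>separated\<close>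
  requires.\<close>

definition pot0 :: "complex \<Rightarrow> complex" where
  "pot0 z = 2 * (wp (z + p) + wp (z - p))"

definition pot1 :: "complex \<Rightarrow> complex" where
  "pot1 z = zeta (z + p) - zeta (z - p)"

lemma potential_split: "Q A z = pot0 z + A * pot1 z + lame_B \<tau> p A"
  by (simp add: lame_potential_def pot0_def pot1_def)

lemma pot_holomorphic: "pot0 holomorphic_on - S" "pot1 holomorphic_on - S"
proof -
  have "(\<lambda>z. Q 0 z - lame_B \<tau> p 0) holomorphic_on - S"
    by (intro holomorphic_intros potential_holomorphic)
  then show p0: "pot0 holomorphic_on - S"
    by (simp add: potential_split)
  have "(\<lambda>z. Q 1 z - lame_B \<tau> p 1 - pot0 z) holomorphic_on - S"
    by (intro holomorphic_intros potential_holomorphic p0)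
  then show "pot1 holomorphic_on - S"
    by (simp add: potential_split)
qed

lemma pot_bounded:
  assumes "compact C" "C \<inter> S = {}"
  obtains M where "\<And>z. z \<in> C \<Longrightarrow> norm (pot0 z) \<le> M" "\<And>z. z \<in> C \<Longrightarrow> norm (pot1 z) \<le> M"
proof -
  have "C \<subseteq> - S" using assms by blast
  then have "continuous_on C pot0" "continuous_on C pot1"
    using pot_holomorphic holomorphic_on_imp_continuous_on holomorphic_on_subset by blast+
  then obtain M0 M1 where M: "\<forall>z\<in>C. norm (pot0 z) \<le> M0" "\<forall>z\<in>C. norm (pot1 z) \<le> M1"
    using continuous_on_compact_bounded[OF _ assms(1), of pot0]
      continuous_on_compact_bounded[OF _ assms(1), of pot1] by auto
  show ?thesis by (rule that[of "max M0 M1"]) (use M in \<open>auto simp: le_max_iff_disj\<close>)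
qed

text \<open>The Picard solution on \<open>U\<close> depends holomorphically on \<open>A\<close>, and
  by uniqueness every global solution with the same data coincides with it there.\<close>

lemma local_solution_holomorphic:
  assumes A0: "A0 \<noteq> 0" and U: "open U" "convex U" "U \<subseteq> C" "z0 \<in> U" "z1 \<in> U"
    and C: "compact C" "C \<inter> S = {}"
  obtains V f g where "open V" "A0 \<in> V" "f holomorphic_on V" "g holomorphic_on V"
    "\<And>A y. A \<in> V \<Longrightarrow> ode_solution (Q A) S UNIV y \<Longrightarrow> y z0 = a \<Longrightarrow> deriv y z0 = b \<Longrightarrow>
      y z1 = f A \<and> deriv y z1 = g A"
proof -
  \<comment> \<open>The radius keeps the closed disc away from the pole of \<open>lame_B\<close> at
    \<open>0\<close>, so that \<open>lame_B\<close> is bounded on it.\<close>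
  define V where "V = ball A0 (norm A0 / 2)"
  let ?cV = "cball A0 (norm A0 / 2)"
  have V0: "0 \<notin> ?cV" using A0 by simp
  have V: "open V" "A0 \<in> V" "V \<subseteq> ?cV" using A0 by (auto simp: V_def)
  have B: "(\<lambda>A. lame_B \<tau> p A) holomorphic_on - {0}"
    unfolding lame_B_def by (intro holomorphic_intros) auto
  have BV: "(\<lambda>A. lame_B \<tau> p A) holomorphic_on V"
    by (rule holomorphic_on_subset[OF B]) (use V V0 in auto)
  have "continuous_on ?cV (\<lambda>A. lame_B \<tau> p A)"
    by (rule holomorphic_on_imp_continuous_on[OF holomorphic_on_subset[OF B]]) (use V0 in auto)
  then obtain MB where MB: "\<And>A. A \<in> ?cV \<Longrightarrow> norm (lame_B \<tau> p A) \<le> MB"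
    using continuous_on_compact_bounded[OF _ compact_cball] by blast
  obtain M where M: "\<And>z. z \<in> C \<Longrightarrow> norm (pot0 z) \<le> M" "\<And>z. z \<in> C \<Longrightarrow> norm (pot1 z) \<le> M"
    using pot_bounded[OF C] by blast
  have US: "U \<inter> S = {}" "U \<subseteq> - S" using U C by auto
  have bU: "bounded U" using U(3) compact_imp_bounded[OF C(1)] bounded_subset by blast
  define coef where "coef = (\<lambda>p z A. if p then 1 else Q A z)"
  have sep: "separated U V (coef q)" for q
  proof (cases q)
    case True
    then show ?thesis using separated_left[of "\<lambda>_. 1" U V] by (simp add: coef_def)
  next
    case False
    have "separated U V (\<lambda>z A. pot0 z + pot1 z * A + lame_B \<tau> p A)"
      using pot_holomorphic US(2) BV
      by (intro separated.add separated_left separated.tensor separated_right)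
         (auto intro: holomorphic_on_subset)
    then show ?thesis using False by (simp add: coef_def potential_split mult.commute)
  qed
  let ?C = "max 1 (M + 2 * norm A0 * M + MB)"
  have bnd: "norm (coef q z A) \<le> ?C" if z: "z \<in> U" and A: "A \<in> V" for q z A
  proof (cases q)
    case False
    have zC: "z \<in> C" and AV: "A \<in> ?cV" using z U A V by auto
    have "norm A \<le> norm A0 + norm A0 / 2"
      using AV norm_triangle_ineq[of A0 "A - A0"] by (simp add: dist_norm norm_minus_commute)
    then have nA: "norm A \<le> 2 * norm A0" using norm_ge_zero[of A0] by linarith
    have "norm (Q A z) \<le> norm (pot0 z) + norm A * norm (pot1 z) + norm (lame_B \<tau> p A)"
      unfolding potential_split norm_mult[symmetric] by (intro norm_triangle_le add_mono order_refl)
    also have "\<dots> \<le> M + 2 * norm A0 * M + MB"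
      using M[OF zC] MB[OF AV] nA by (intro add_mono mult_mono) auto
    finally show ?thesis using False by (simp add: coef_def)
  qed (simp add: coef_def)
  obtain F where F: "\<And>q A. F q z0 A = (if q then a else b)"
    "\<And>q z A. z \<in> U \<Longrightarrow> A \<in> V \<Longrightarrow>
       ((\<lambda>z. F q z A) has_field_derivative coef q z A * F (\<not> q) z A) (at z)"
    "\<And>q z. z \<in> U \<Longrightarrow> (\<lambda>A. F q z A) holomorphic_on V"
    by (rule linear_system_solution[where coef = coef and init = "\<lambda>q. if q then a else b",
        OF U(1,2) bU U(4) V(1) sep bnd]) (assumption | rule that)+
  have "y z1 = F True z1 A \<and> deriv y z1 = F False z1 A"
    if A: "A \<in> V" and y: "ode_solution (Q A) S UNIV y" "y z0 = a" "deriv y z0 = b" for A y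
  proof -
    have op: "U - S = U" using US by blast
    have d: "((\<lambda>z. F True z A) has_field_derivative F False z A) (at z)"
      "((\<lambda>z. F False z A) has_field_derivative Q A z * F True z A) (at z)" if "z \<in> U" for z
      using F(2)[OF that A, of True] F(2)[OF that A, of False] by (simp_all add: coef_def)
    then have "(\<lambda>z. F True z A) holomorphic_on U" using holomorphic_on_open[OF U(1)] by blast
    then have m: "(\<lambda>z. F True z A) meromorphic_on U"
      by (intro analytic_on_imp_meromorphic_on) (simp add: analytic_on_open U(1))
    note sol = ode_solutionI[OF m, of S "\<lambda>z. F False z A" "Q A", unfolded op, OF U(1) d]
    have sol1: "ode_solution (Q A) S U (\<lambda>z. F True z A)" by (rule sol(1))
    have sol2: "deriv (\<lambda>z. F True z A) z = F False z A" if "z \<in> U" for z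
      by (rule sol(2)) (use that in auto)
    have yU: "ode_solution (Q A) S U y" using y(1) by (rule ode_solution_subset) auto
    have eq: "y z = F True z A" if "z \<in> U" for z
      by (rule unique[OF U(1) convex_connected[OF U(2)] yU sol1, of z0])
         (use U op that y F(1) sol2 in auto)
    have "deriv y z1 = deriv (\<lambda>z. F True z A) z1"
      by (rule cong(2)[OF U(1) sol1]) (use eq op U in auto)
    then show ?thesis using eq[OF U(5)] sol2[OF U(5)] by simp
  qed
  with that[OF V(1,2) F(3)[OF U(5), of True] F(3)[OF U(5), of False]] show ?thesis by blast
qed

lemma fundamental_solutions:
  assumes "A \<noteq> 0" "z0 \<notin> S"
  obtains Y1 Y2 where
    "ode_solution (Q A) S UNIV Y1" "Y1 z0 = 1" "deriv Y1 z0 = 0"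
    "ode_solution (Q A) S UNIV Y2" "Y2 z0 = 0" "deriv Y2 z0 = 1"
proof -
  have "\<And>a b. \<exists>y. ode_solution (Q A) S UNIV y \<and> y z0 = a \<and> deriv y z0 = b"
    using solvable[OF assms(1)] assms(2) unfolding ode_solvable_def by blast
  then show ?thesis using that by metis
qed

lemma period_in_lattice: "period \<tau> k \<in> L"
  by (simp add: period_def)

lemma period_nonzero: "period \<tau> k \<noteq> 0"
  using Im_pos by (auto simp: period_def)

text \<open>Base point and strip may be chosen for each \<open>A0\<close> separately: by
  \<open>hill_discriminant_eq\<close> the value does not depend on them, so the local formulas
  describe one function.\<close>

lemma hill_discriminant_holomorphic: "hill_discriminant \<tau> p k holomorphic_on - {0}"
  unfolding holomorphic_on_def
proof
  fix A0 :: complex assume "A0 \<in> - {0}"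
  then have A0: "A0 \<noteq> 0" by simp
  let ?\<omega> = "period \<tau> k"
  obtain z0 where z0: "\<And>t. z0 + of_real t * ?\<omega> \<notin> S" using regular_line[OF period_nonzero[of k]] by blast
  let ?K = "closed_segment z0 (z0 + ?\<omega>)"
  have K0: "?K \<inter> S = {}"
  proof -
    have "(1 - u) *\<^sub>R z0 + u *\<^sub>R (z0 + ?\<omega>) = z0 + of_real u * ?\<omega>" for u
      by (simp add: scaleR_conv_of_real algebra_simps)
    then show ?thesis using z0 by (auto simp: closed_segment_def)
  qed
  obtain U C where UC: "open U" "convex U" "compact C" "?K \<subseteq> U" "U \<subseteq> C" "C \<inter> S = {}"
    using regular_strip[OF compact_segment convex_closed_segment K0] .
  have zU: "z0 \<in> U" "z0 + ?\<omega> \<in> U" using UC(4) by auto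
  have z0S: "z0 \<notin> S" using z0[of 0] by simp
  obtain V1 f1 g1 where V1: "open V1" "A0 \<in> V1" "f1 holomorphic_on V1"
    "\<And>A y. A \<in> V1 \<Longrightarrow> ode_solution (Q A) S UNIV y \<Longrightarrow> y z0 = 1 \<Longrightarrow> deriv y z0 = 0 \<Longrightarrow>
      y (z0 + ?\<omega>) = f1 A \<and> deriv y (z0 + ?\<omega>) = g1 A"
    by (rule local_solution_holomorphic[OF A0 UC(1,2,5) zU UC(3,6), where a = 1 and b = 0])
      (erule that; assumption)
  obtain V2 f2 g2 where V2: "open V2" "A0 \<in> V2" "g2 holomorphic_on V2"
    "\<And>A y. A \<in> V2 \<Longrightarrow> ode_solution (Q A) S UNIV y \<Longrightarrow> y z0 = 0 \<Longrightarrow> deriv y z0 = 1 \<Longrightarrow>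
      y (z0 + ?\<omega>) = f2 A \<and> deriv y (z0 + ?\<omega>) = g2 A"
    by (rule local_solution_holomorphic[OF A0 UC(1,2,5) zU UC(3,6), where a = 0 and b = 1])
      (erule that; assumption)
  let ?V = "V1 \<inter> V2 \<inter> - {0}"
  have V: "open ?V" "A0 \<in> ?V" using V1 V2 A0 by auto
  have eq: "(f1 A + g2 A) / 2 = hill_discriminant \<tau> p k A" if A: "A \<in> ?V" for A
  proof -
    have "A \<noteq> 0" using A by auto
    then obtain Y1 Y2 where Y:
      "ode_solution (Q A) S UNIV Y1" "Y1 z0 = 1" "deriv Y1 z0 = 0"
      "ode_solution (Q A) S UNIV Y2" "Y2 z0 = 0" "deriv Y2 z0 = 1"
      using fundamental_solutions[OF _ z0S] by blast
    show ?thesis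
      using hill_discriminant_eq[OF \<open>A \<noteq> 0\<close> z0S period_in_lattice Y]
        V1(4)[OF _ Y(1-3)] V2(4)[OF _ Y(4-6)] A by simp
  qed
  have "(\<lambda>A. (f1 A + g2 A) / 2) holomorphic_on ?V"
    by (intro holomorphic_intros holomorphic_on_subset[OF V1(3)] holomorphic_on_subset[OF V2(3)]) auto
  then have "hill_discriminant \<tau> p k holomorphic_on ?V"
    by (rule holomorphic_transform) (rule eq)
  then have "hill_discriminant \<tau> p k field_differentiable at A0"
    by (rule holomorphic_on_imp_differentiable_at) (use V in auto)
  then show "hill_discriminant \<tau> p k field_differentiable at A0 within - {0}"
    by (rule field_differentiable_at_within)
qed

end

section \<open>Growth near the origin\<close>

lemma norm_diff_le_derivative_bound:
  fixes f :: "real \<Rightarrow> complex"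
  assumes "a \<le> b" and d: "\<And>t. t \<in> {a..b} \<Longrightarrow> (f has_vector_derivative f' t) (at t)"
    and bnd: "\<And>t. t \<in> {a..b} \<Longrightarrow> norm (f' t) \<le> B"
  shows "norm (f b - f a) \<le> B * (b - a)"
proof (cases "a = b")
  case False
  have "norm (f b - f a) \<le> B * b - B * a"
  proof (rule differentiable_bound_general[where f' = f' and \<phi>' = "\<lambda>_. B"])
    show "continuous_on {a..b} f"
      by (intro continuous_at_imp_continuous_on ballI has_vector_derivative_continuous[OF d])
    show "((*) B has_vector_derivative B) (at x)" for x
      by (auto intro!: derivative_eq_intros)
  qed (use assms False in \<open>auto intro!: continuous_intros\<close>)
  then show ?thesis by (simp add: algebra_simps)
qed simp

lemma exp_has_vector_derivative:
  "((\<lambda>t. exp (of_real (a * t)) :: complex) has_vector_derivative of_real a * exp (of_real (a * t))) (at t)"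
proof -
  have "((\<lambda>t. of_real (a * t) :: complex) has_vector_derivative of_real a) (at t)"
    unfolding of_real_mult by (auto intro!: derivative_eq_intros)
  from field_vector_diff_chain_at[OF this DERIV_exp] show ?thesis by (simp add: o_def)
qed

text \<open>
  \<open>u = y' + l y\<close> and \<open>v = y' - l y\<close> decouple up to the perturbation \<open>q\<close>; the maximum of
  \<open>exp (-l t) (\<bar>u\<bar> + \<bar>v\<bar>)\<close> bounds the perturbation terms.
\<close>

lemma wkb_estimate:
  fixes y y' q :: "real \<Rightarrow> complex" and l M :: real
  assumes l: "l > 0" "8 * M \<le> l" and q: "\<And>t. t \<in> {0..1} \<Longrightarrow> norm (q t) \<le> M"
    and y: "\<And>t. t \<in> {0..1} \<Longrightarrow> (y has_vector_derivative y' t) (at t)"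
    and y': "\<And>t. t \<in> {0..1} \<Longrightarrow> (y' has_vector_derivative (of_real (l\<^sup>2) + q t) * y t) (at t)"
  defines "s \<equiv> norm (y' 0 + of_real l * y 0) + norm (y' 0 - of_real l * y 0)"
  shows "norm ((y' 1 + of_real l * y 1) - exp l * (y' 0 + of_real l * y 0)) \<le> exp l * s / 8"
    and "norm ((y' 1 - of_real l * y 1) - exp (- l) * (y' 0 - of_real l * y 0)) \<le> exp l * s / 8"
proof -
  define u where "u t = y' t + of_real l * y t" for t
  define v where "v t = y' t - of_real l * y t" for t
  define h where "h t = exp (- l * t) * (norm (u t) + norm (v t))" for t
  have M0: "M \<ge> 0" using q[of 0] norm_ge_zero[of "q 0"] by (simp del: norm_ge_zero)
  have du: "(u has_vector_derivative of_real l * u t + q t * y t) (at t)"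
    and dv: "(v has_vector_derivative - of_real l * v t + q t * y t) (at t)" if "t \<in> {0..1}" for t
    using y[OF that] y'[OF that] unfolding u_def v_def
    by (auto intro!: derivative_eq_intros simp: algebra_simps power2_eq_square)
  have "continuous_on {0..1} u"
    by (intro continuous_at_imp_continuous_on ballI has_vector_derivative_continuous[OF du])
  moreover have "continuous_on {0..1} v"
    by (intro continuous_at_imp_continuous_on ballI has_vector_derivative_continuous[OF dv])
  ultimately have "continuous_on {0..1} h" unfolding h_def by (intro continuous_intros)
  then obtain t0 where t0: "t0 \<in> {0..1}" "\<And>t. t \<in> {0..1} \<Longrightarrow> h t \<le> h t0"
    using continuous_attains_sup[of "{0..1::real}" h] by auto
  define m where "m = h t0"
  have m0: "m \<ge> 0" by (simp add: m_def h_def)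
  \<comment> \<open>\<open>y = (u - v) / (2 * l)\<close>, and \<open>8 * M \<le> l\<close> turns the
    factor \<open>M / (2 * l)\<close> into \<open>1 / 16\<close>.\<close>
  have qy: "norm (q t * y t) \<le> exp (l * t) * (m / 16)" if t: "t \<in> {0..1}" for t
  proof -
    have "y t = (u t - v t) / of_real (2 * l)" using l by (simp add: u_def v_def field_simps)
    then have "norm (y t) = norm (u t - v t) / (2 * l)" using l by (simp add: norm_divide norm_mult)
    also have "\<dots> \<le> (norm (u t) + norm (v t)) / (2 * l)"
      using l by (intro divide_right_mono norm_triangle_ineq4) auto
    finally have "norm (q t * y t) \<le> M * ((norm (u t) + norm (v t)) / (2 * l))"
      unfolding norm_mult using q[OF t] M0 by (intro mult_mono) auto
    also have "\<dots> = (M / (2 * l)) * (norm (u t) + norm (v t))" by simp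
    also have "\<dots> \<le> (1 / 16) * (norm (u t) + norm (v t))"
      using l by (intro mult_right_mono) (auto simp: field_simps)
    also have "norm (u t) + norm (v t) = exp (l * t) * h t"
      by (simp add: h_def exp_minus field_simps)
    also have "\<dots> \<le> exp (l * t) * m" using t0(2)[OF t] by (simp add: m_def)
    finally show ?thesis by simp
  qed
  \<comment> \<open>Variation of constants: after multiplication by \<open>exp (- l * t)\<close>
    only the perturbation is left in the derivative, of size at most \<open>m / 16\<close>.\<close>
  have U: "norm (u T - exp (l * T) * u 0) \<le> exp (l * T) * (m / 16)" if T: "T \<in> {0..1}" for T
  proof -
    let ?f = "\<lambda>t. exp (of_real (- l * t)) * u t"
    have "norm (?f T - ?f 0) \<le> m / 16 * (T - 0)"
    proof (rule norm_diff_le_derivative_bound)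
      fix t assume "t \<in> {0..T}"
      then have t: "t \<in> {0..1}" using T by auto
      from has_vector_derivative_mult[OF exp_has_vector_derivative[of "- l"] du[OF t]]
      show "(?f has_vector_derivative exp (of_real (- l * t)) * (q t * y t)) (at t)"
        by (simp add: algebra_simps)
      have "norm (exp (of_real (- l * t)) * (q t * y t)) \<le> exp (- l * t) * (exp (l * t) * (m / 16))"
        unfolding norm_mult[of "exp (of_real (- l * t))"] using qy[OF t] by (intro mult_mono) auto
      also have "\<dots> = m / 16" by (simp add: exp_minus)
      finally show "norm (exp (of_real (- l * t)) * (q t * y t)) \<le> m / 16" .
    qed (use T in auto)
    also have "\<dots> \<le> m / 16" using T m0 by (simp add: mult_left_le)
    finally have "exp (l * T) * norm (?f T - ?f 0) \<le> exp (l * T) * (m / 16)" by simp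
    moreover have "exp (l * T) * norm (?f T - ?f 0) = norm (of_real (exp (l * T)) * (?f T - ?f 0))"
      by (simp add: norm_mult)
    moreover have "of_real (exp (l * T)) * exp (of_real (- l * T)) = (1 :: complex)"
      unfolding exp_of_real of_real_mult[symmetric] exp_add[symmetric] by simp
    then have "of_real (exp (l * T)) * (?f T - ?f 0) = u T - exp (l * T) * u 0"
      by (simp add: right_diff_distrib flip: mult.assoc)
    ultimately show ?thesis by (simp only:)
  qed
  \<comment> \<open>The integrating factor grows here, so the integrand is bounded by its largest
    bound, at \<open>T\<close>. The result is no better than for \<open>u\<close>, although the
    unperturbed \<open>v\<close> decays.\<close>
  have V: "norm (v T - exp (- l * T) * v 0) \<le> exp (l * T) * (m / 16)" if T: "T \<in> {0..1}" for T
  proof -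
    let ?f = "\<lambda>t. exp (of_real (l * t)) * v t"
    have "norm (?f T - ?f 0) \<le> exp (l * T) * (exp (l * T) * (m / 16)) * (T - 0)"
    proof (rule norm_diff_le_derivative_bound)
      fix t assume tT: "t \<in> {0..T}"
      then have t: "t \<in> {0..1}" using T by auto
      from has_vector_derivative_mult[OF exp_has_vector_derivative[of l] dv[OF t]]
      show "(?f has_vector_derivative exp (of_real (l * t)) * (q t * y t)) (at t)"
        by (simp add: algebra_simps)
      have le: "exp (l * t) \<le> exp (l * T)" using tT l by simp
      have "norm (exp (of_real (l * t)) * (q t * y t)) \<le> exp (l * t) * (exp (l * t) * (m / 16))"
        unfolding norm_mult[of "exp (of_real (l * t))"] using qy[OF t] by (intro mult_mono) auto
      also have "\<dots> \<le> exp (l * T) * (exp (l * T) * (m / 16))"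
        using le m0 by (intro mult_mono) auto
      finally show "norm (exp (of_real (l * t)) * (q t * y t)) \<le> exp (l * T) * (exp (l * T) * (m / 16))" .
    qed (use T in auto)
    also have "\<dots> \<le> exp (l * T) * (exp (l * T) * (m / 16))" using T m0 by (simp add: mult_left_le)
    finally have "exp (- l * T) * norm (?f T - ?f 0) \<le> exp (- l * T) * (exp (l * T) * (exp (l * T) * (m / 16)))"
      by (intro mult_left_mono) auto
    also have "\<dots> = exp (l * T) * (m / 16)" by (simp add: exp_minus)
    finally have "exp (- l * T) * norm (?f T - ?f 0) \<le> exp (l * T) * (m / 16)" .
    moreover have "exp (- l * T) * norm (?f T - ?f 0) = norm (of_real (exp (- l * T)) * (?f T - ?f 0))"
      by (simp add: norm_mult)
    moreover have "of_real (exp (- l * T)) * exp (of_real (l * T)) = (1 :: complex)"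
      unfolding exp_of_real of_real_mult[symmetric] exp_add[symmetric] by simp
    then have "of_real (exp (- l * T)) * (?f T - ?f 0) = v T - exp (- l * T) * v 0"
      by (simp add: right_diff_distrib flip: mult.assoc)
    ultimately show ?thesis by (simp only:)
  qed
  \<comment> \<open>The two estimates at the maximum point bound \<open>m\<close> in terms of
    itself; hence \<open>m \<le> 8 / 7 * s\<close>, more than enough for
    \<open>m / 16 \<le> s / 8\<close>.\<close>
  have "m \<le> s + m / 8"
  proof -
    have "norm (u t0) \<le> exp (l * t0) * (norm (u 0) + m / 16)"
      using U[OF t0(1)] norm_triangle_ineq[of "u t0 - exp (l * t0) * u 0" "exp (l * t0) * u 0"]
      by (simp add: norm_mult algebra_simps)
    moreover have "norm (v t0) \<le> exp (l * t0) * (norm (v 0) + m / 16)"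
    proof -
      have "exp (- l * t0) * norm (v 0) \<le> exp (l * t0) * norm (v 0)"
        using t0(1) l by (intro mult_right_mono) auto
      then show ?thesis
        using V[OF t0(1)] norm_triangle_ineq[of "v t0 - exp (- l * t0) * v 0" "exp (- l * t0) * v 0"]
        by (simp add: norm_mult algebra_simps)
    qed
    ultimately have "norm (u t0) + norm (v t0) \<le> exp (l * t0) * (s + m / 8)"
      by (simp add: s_def u_def v_def algebra_simps)
    then have "m \<le> exp (- l * t0) * (exp (l * t0) * (s + m / 8))"
      unfolding m_def h_def by (intro mult_left_mono) auto
    also have "\<dots> = s + m / 8" by (simp add: exp_minus)
    finally show ?thesis .
  qed
  then have m: "exp l * (m / 16) \<le> exp l * s / 8"
    using m0 mult_left_mono[of "m / 16" "s / 8" "exp l"] by simp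
  show "norm ((y' 1 + of_real l * y 1) - exp l * (y' 0 + of_real l * y 0)) \<le> exp l * s / 8"
    using order_trans[OF U[of 1, unfolded mult_1_right] m] by (simp add: u_def)
  show "norm ((y' 1 - of_real l * y 1) - exp (- l) * (y' 0 - of_real l * y 0)) \<le> exp l * s / 8"
    using order_trans[OF V[of 1, unfolded mult_1_right] m] by (simp add: v_def)
qed

text \<open>In the coordinates \<open>y' + l y\<close> and \<open>y' - l y\<close> the diagonal
  entries are close to \<open>exp l\<close> and \<open>exp (- l)\<close>, each with error at most
  \<open>exp l / 8\<close>, so the leading exponential cannot cancel.\<close>

lemma trace_lower_bound:
  fixes y1 y1' y2 y2' q :: "real \<Rightarrow> complex" and l M :: real
  assumes l: "l > 0" "8 * M \<le> l" and q: "\<And>t. t \<in> {0..1} \<Longrightarrow> norm (q t) \<le> M"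
    and y1: "\<And>t. t \<in> {0..1} \<Longrightarrow> (y1 has_vector_derivative y1' t) (at t)"
      "\<And>t. t \<in> {0..1} \<Longrightarrow> (y1' has_vector_derivative (of_real (l\<^sup>2) + q t) * y1 t) (at t)"
    and y2: "\<And>t. t \<in> {0..1} \<Longrightarrow> (y2 has_vector_derivative y2' t) (at t)"
      "\<And>t. t \<in> {0..1} \<Longrightarrow> (y2' has_vector_derivative (of_real (l\<^sup>2) + q t) * y2 t) (at t)"
    and init: "y1 0 = 1" "y1' 0 = 0" "y2 0 = 0" "y2' 0 = 1"
  shows "norm (y1 1 + y2' 1) \<ge> exp l / 2"
proof -
  let ?l = "of_real l :: complex"
  \<comment> \<open>The solution \<open>a\<close> starts with coordinates \<open>(1, 0)\<close> and
    \<open>b\<close> with \<open>(0, 1)\<close>, so \<open>s = 1\<close> in both estimates.\<close>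
  define a where "a t = y1 t / (2 * ?l) + y2 t / 2" for t
  define a' where "a' t = y1' t / (2 * ?l) + y2' t / 2" for t
  define b where "b t = - y1 t / (2 * ?l) + y2 t / 2" for t
  define b' where "b' t = - y1' t / (2 * ?l) + y2' t / 2" for t
  have l0: "?l \<noteq> 0" using l by simp
  have da: "(a has_vector_derivative a' t) (at t)"
      "(a' has_vector_derivative (of_real (l\<^sup>2) + q t) * a t) (at t)"
    and db: "(b has_vector_derivative b' t) (at t)"
      "(b' has_vector_derivative (of_real (l\<^sup>2) + q t) * b t) (at t)" if "t \<in> {0..1}" for t
    using y1[OF that] y2[OF that] unfolding a_def a'_def b_def b'_def
    by (auto intro!: derivative_eq_intros
        simp: distrib_left add_divide_distrib distrib_right right_diff_distrib)
  let ?u = "a' 1 + ?l * a 1" and ?v = "b' 1 - ?l * b 1"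
  have u: "norm (?u - of_real (exp l)) \<le> exp l / 8"
    using wkb_estimate(1)[OF l q da] init l0 by (simp add: a_def a'_def)
  have v: "norm (?v - of_real (exp (- l))) \<le> exp l / 8"
    using wkb_estimate(2)[OF l q db] init l0 by (simp add: b_def b'_def)
  have "exp l + exp (- l) = norm (of_real (exp l + exp (- l)) :: complex)"
    unfolding norm_of_real using exp_gt_zero[of l] exp_gt_zero[of "- l"] by linarith
  also have "\<dots> = norm ((?u + ?v) - ((?u - of_real (exp l)) + (?v - of_real (exp (- l)))))"
    by simp
  also have "\<dots> \<le> norm (?u + ?v) + (exp l / 8 + exp l / 8)"
    by (intro order_trans[OF norm_triangle_ineq4] add_left_mono order_trans[OF norm_triangle_ineq] add_mono u v)
  finally have "exp l / 2 \<le> norm (?u + ?v)"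
    using exp_gt_zero[of l] exp_gt_zero[of "- l"] by linarith
  also have "?u + ?v = y1 1 + y2' 1"
    using l0 by (simp add: a_def a'_def b_def b'_def field_simps)
  finally show ?thesis .
qed

text \<open>Unless \<open>f\<close> vanishes near \<open>0\<close>, it is
  \<open>g w * w powi n\<close> there with \<open>g\<close> bounded. The exponent
  \<open>\<bar>n\<bar>\<close> treats zeros and poles alike, since
  \<open>norm w < 1\<close>.\<close>

lemma not_essential_imp_polynomial_bound:
  fixes f :: "complex \<Rightarrow> complex"
  assumes "isolated_singularity_at f 0" "not_essential f 0"
  obtains r K N where "r > 0" "\<And>w. w \<noteq> 0 \<Longrightarrow> norm w < r \<Longrightarrow> norm (f w) \<le> K / norm w ^ N"
proof (cases "\<exists>\<^sub>Fw in (at 0). f w \<noteq> 0")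
  case True
  define n where "n = zorder f 0"
  define g where "g = zor_poly f 0"
  obtain r where r: "r > 0" "g holomorphic_on cball 0 r"
    "\<And>w. w \<in> cball 0 r - {0} \<Longrightarrow> f w = g w * w powi n"
    using zorder_exist[OF assms True] by (auto simp: n_def g_def)
  obtain K where K: "\<And>w. w \<in> cball 0 r \<Longrightarrow> norm (g w) \<le> K"
  proof -
    have "bounded (g ` cball 0 r)"
      by (intro compact_imp_bounded compact_continuous_image holomorphic_on_imp_continuous_on r) simp
    then obtain K where "\<forall>x\<in>cball 0 r. norm (g x) \<le> K" by (auto simp: bounded_iff)
    then show ?thesis using that by blast
  qed
  show ?thesis
  proof (rule that[of "min r 1"])
    fix w :: complex assume w: "w \<noteq> 0" "norm w < min r 1"
    have "norm (w powi n) \<le> 1 / norm w ^ nat \<bar>n\<bar>"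
    proof (cases "n \<ge> 0")
      case True
      have "norm w ^ nat n * norm w ^ nat n \<le> 1 * 1"
        using w by (intro mult_mono power_le_one) auto
      then show ?thesis using True w by (simp add: power_int_def norm_power field_simps)
    next
      case False
      then show ?thesis by (simp add: power_int_def norm_power norm_inverse norm_divide field_simps)
    qed
    moreover have "norm (f w) = norm (g w) * norm (w powi n)" using r(3) w by (simp add: norm_mult)
    moreover have "norm (g w) \<le> K" using K w by simp
    moreover have "0 \<le> K" using K[of w] w norm_ge_zero[of "g w"] by (simp del: norm_ge_zero)
    ultimately have "norm (f w) \<le> K * (1 / norm w ^ nat \<bar>n\<bar>)"
      by (simp only:) (rule mult_mono; simp)
    then show "norm (f w) \<le> K / norm w ^ nat \<bar>n\<bar>" by simp
  qed (use r in auto)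
next
  case False
  then have "\<forall>\<^sub>F w in at 0. f w = 0" by (simp add: frequently_def)
  then obtain r where "r > 0" "\<And>w. w \<noteq> 0 \<Longrightarrow> norm w < r \<Longrightarrow> f w = 0"
    unfolding eventually_at by (auto simp: dist_norm)
  then show ?thesis by (intro that[of r 0 0]) auto
qed

section \<open>Exponential growth along a sequence tending to the origin\<close>

context lame
begin

lemma hill_discriminant_growth:
  assumes c: "deriv wp (2 * p) \<noteq> 0"
  obtains a n0 where "a \<noteq> 0"
    "\<And>n. n \<ge> n0 \<Longrightarrow> exp (real n) / 4 \<le> norm (hill_discriminant \<tau> p k (a / of_nat n ^ 2))"
proof -
  let ?\<omega> = "period \<tau> k"
  define c where "c = deriv wp (2 * p)"
  \<comment> \<open>Chosen so that for \<open>A = a / n ^ 2\<close> the polar term of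
    \<open>lame_B\<close>, multiplied by \<open>?\<omega>\<^sup>2\<close>, is exactly
    \<open>n ^ 2\<close>.\<close>
  define a where "a = - 2 * c * ?\<omega>\<^sup>2"
  have a: "a \<noteq> 0" using c period_nonzero[of k] by (simp add: a_def c_def)
  obtain z0 where z0: "\<And>t. z0 + of_real t * ?\<omega> \<notin> S"
    using regular_line[OF period_nonzero[of k]] by blast
  have z0S: "z0 \<notin> S" using z0[of 0] by simp
  let ?C = "(\<lambda>t. z0 + of_real t * ?\<omega>) ` {0..1::real}"
  have "compact ?C" by (intro compact_continuous_image continuous_intros) auto
  moreover have "?C \<inter> S = {}" using z0 by auto
  ultimately obtain M where M: "\<And>z. z \<in> ?C \<Longrightarrow> norm (pot0 z) \<le> M" "\<And>z. z \<in> ?C \<Longrightarrow> norm (pot1 z) \<le> M"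
    using pot_bounded by blast
  define M' where "M' = (norm ?\<omega>)\<^sup>2 * (M + M + (1 / 4 + norm (zeta (2 * p)) + norm (wp (2 * p))))"
  \<comment> \<open>The three bounds ensure \<open>A \<noteq> 0\<close>, the smallness condition of
    \<open>trace_lower_bound\<close> with \<open>l = n\<close>, and
    \<open>norm A \<le> 1\<close>.\<close>
  obtain n0 :: nat where n0: "real n0 \<ge> max 1 (max (8 * M') (norm a))"
    using real_arch_simple by blast
  have "exp (real n) / 4 \<le> norm (hill_discriminant \<tau> p k (a / of_nat n ^ 2))" if n: "n \<ge> n0" for n
  proof -
    define A where "A = a / of_nat n ^ 2"
    have nge: "real n \<ge> 1" "real n \<ge> 8 * M'" "real n \<ge> norm a" using n0 n by auto
    have A0: "A \<noteq> 0" using a nge by (auto simp: A_def)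
    have "norm A = norm a / real n ^ 2" by (simp add: A_def norm_divide norm_power)
    also have "\<dots> \<le> 1"
    proof -
      have "norm a * 1 \<le> real n * real n" using nge by (intro mult_mono) auto
      then show ?thesis using nge by (simp add: power2_eq_square)
    qed
    finally have A1: "norm A \<le> 1" .
    obtain Y1 Y2 where Y1: "ode_solution (Q A) S UNIV Y1" "Y1 z0 = 1" "deriv Y1 z0 = 0"
      and Y2: "ode_solution (Q A) S UNIV Y2" "Y2 z0 = 0" "deriv Y2 z0 = 1"
      using fundamental_solutions[OF A0 z0S] by blast
    define \<gamma> where "\<gamma> t = z0 + of_real t * ?\<omega>" for t
    \<comment> \<open>What remains of the rescaled potential without its polar term; for
      \<open>norm A \<le> 1\<close> it is bounded by \<open>M'\<close>, independently of
      \<open>n\<close>.\<close>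
    define q where "q t = ?\<omega>\<^sup>2 * (pot0 (\<gamma> t) + A * pot1 (\<gamma> t) + (A\<^sup>2 / 4 - A * zeta (2 * p) - wp (2 * p)))" for t
    have q: "norm (q t) \<le> M'" if t: "t \<in> {0..1}" for t
    proof -
      have tC: "\<gamma> t \<in> ?C" using t by (auto simp: \<gamma>_def)
      have 1: "norm (A\<^sup>2 / 4 - A * zeta (2 * p) - wp (2 * p)) \<le> 1 / 4 + norm (zeta (2 * p)) + norm (wp (2 * p))"
      proof -
        have "norm (A\<^sup>2 / 4 - A * zeta (2 * p) - wp (2 * p))
            \<le> norm (A\<^sup>2 / 4) + norm (A * zeta (2 * p)) + norm (wp (2 * p))"
          by (intro order_trans[OF norm_triangle_ineq4] add_mono norm_triangle_ineq4 order_refl)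
        also have "\<dots> \<le> 1 / 4 + norm (zeta (2 * p)) + norm (wp (2 * p))"
          using A1 by (intro add_mono) (auto simp: norm_divide norm_mult norm_power power_le_one mult_left_le_one_le)
        finally show ?thesis .
      qed
      have 2: "norm (A * pot1 (\<gamma> t)) \<le> M"
        using order_trans[OF mult_left_le_one_le[of "norm (pot1 (\<gamma> t))" "norm A"] M(2)[OF tC]] A1
        by (simp add: norm_mult)
      show ?thesis
        unfolding q_def M'_def norm_mult norm_power
        by (intro mult_left_mono order_trans[OF norm_triangle_ineq] add_mono M(1)[OF tC] 1 2) auto
    qed
    have Q: "?\<omega>\<^sup>2 * Q A (\<gamma> t) = of_real ((real n)\<^sup>2) + q t" for t
    proof -
      have "?\<omega>\<^sup>2 * (- 2 * c / A) = of_nat n ^ 2"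
        using a nge period_nonzero[of k] by (simp add: A_def a_def field_simps)
      moreover have "Q A (\<gamma> t) = pot0 (\<gamma> t) + A * pot1 (\<gamma> t) + (A\<^sup>2 / 4 - A * zeta (2 * p) - wp (2 * p)) + (- 2 * c / A)"
        by (simp add: potential_split lame_B_def c_def)
      ultimately have "?\<omega>\<^sup>2 * Q A (\<gamma> t) =
          ?\<omega>\<^sup>2 * (pot0 (\<gamma> t) + A * pot1 (\<gamma> t) + (A\<^sup>2 / 4 - A * zeta (2 * p) - wp (2 * p))) + of_nat n ^ 2"
        by (simp only: distrib_left)
      then show ?thesis by (simp add: q_def)
    qed
    have d\<gamma>: "(\<gamma> has_vector_derivative ?\<omega>) (at t)" for t
      unfolding \<gamma>_def by (auto intro!: derivative_eq_intros)
    have \<gamma>S: "\<gamma> t \<in> UNIV - S" for t using z0 by (simp add: \<gamma>_def)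
    have dY: "((\<lambda>t. Y (\<gamma> t)) has_vector_derivative ?\<omega> * deriv Y (\<gamma> t)) (at t)"
      "((\<lambda>t. deriv Y (\<gamma> t)) has_vector_derivative ?\<omega> * (Q A (\<gamma> t) * Y (\<gamma> t))) (at t)"
      if "ode_solution (Q A) S UNIV Y" for Y t
      using field_vector_diff_chain_at[OF d\<gamma> ode_solutionD(1)[OF that open_diff[OF open_UNIV] \<gamma>S]]
        field_vector_diff_chain_at[OF d\<gamma> ode_solutionD(2)[OF that open_diff[OF open_UNIV] \<gamma>S]]
      by (simp_all add: o_def)
    have "exp (real n) / 2 \<le> norm (Y1 (\<gamma> 1) + deriv Y2 (\<gamma> 1))"
    proof (rule trace_lower_bound[OF _ nge(2) q])
      show "((\<lambda>t. Y1 (\<gamma> t)) has_vector_derivative ?\<omega> * deriv Y1 (\<gamma> t)) (at t)" for t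
        by (rule dY[OF Y1(1)])
      show "((\<lambda>t. ?\<omega> * deriv Y1 (\<gamma> t)) has_vector_derivative (of_real ((real n)\<^sup>2) + q t) * Y1 (\<gamma> t)) (at t)" for t
        using has_vector_derivative_mult_right[OF dY(2)[OF Y1(1)], of ?\<omega>]
        unfolding Q[symmetric] by (simp add: power2_eq_square mult_ac)
      \<comment> \<open>Division by \<open>?\<omega>\<close> restores the derivative
        \<open>1\<close> at \<open>t = 0\<close> with respect to \<open>t\<close>; the diagonal
        entry is still \<open>deriv Y2 (\<gamma> 1)\<close>.\<close>
      show "((\<lambda>t. Y2 (\<gamma> t) / ?\<omega>) has_vector_derivative deriv Y2 (\<gamma> t)) (at t)" for t
        using has_vector_derivative_mult_right[OF dY(1)[OF Y2(1)], of "1 / ?\<omega>"] period_nonzero[of k]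
        by simp
      show "((\<lambda>t. deriv Y2 (\<gamma> t)) has_vector_derivative (of_real ((real n)\<^sup>2) + q t) * (Y2 (\<gamma> t) / ?\<omega>)) (at t)" for t
        using dY(2)[OF Y2(1)] period_nonzero[of k]
        unfolding Q[symmetric] by (simp add: power2_eq_square mult_ac)
    qed (use nge Y1 Y2 in \<open>auto simp: \<gamma>_def\<close>)
    moreover have hill: "hill_discriminant \<tau> p k A = (Y1 (\<gamma> 1) + deriv Y2 (\<gamma> 1)) / 2"
      using hill_discriminant_eq[OF A0 z0S period_in_lattice[of k] Y1 Y2] by (simp add: \<gamma>_def)
    ultimately show ?thesis unfolding A_def[symmetric] hill norm_divide by simp
  qed
  with a that show ?thesis by blast
qed

lemma hill_discriminant_isolated: "isolated_singularity_at (hill_discriminant \<tau> p k) 0"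
  unfolding isolated_singularity_at_def
proof (intro exI conjI)
  show "hill_discriminant \<tau> p k analytic_on ball 0 1 - {0}"
    by (subst analytic_on_open)
       (auto intro: holomorphic_on_subset[OF hill_discriminant_holomorphic])
qed simp

lemma hill_discriminant_essential:
  assumes c: "deriv wp (2 * p) \<noteq> 0"
  shows "\<not> not_essential (hill_discriminant \<tau> p k) 0"
proof
  assume "not_essential (hill_discriminant \<tau> p k) 0"
  then obtain r K N where r: "r > 0"
    "\<And>w. w \<noteq> 0 \<Longrightarrow> norm w < r \<Longrightarrow> norm (hill_discriminant \<tau> p k w) \<le> K / norm w ^ N"
    using not_essential_imp_polynomial_bound[OF hill_discriminant_isolated] by metis
  obtain a n0 where a: "a \<noteq> 0"
    "\<And>n. n \<ge> n0 \<Longrightarrow> exp (real n) / 4 \<le> norm (hill_discriminant \<tau> p k (a / of_nat n ^ 2))"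
    using hill_discriminant_growth[OF c] by metis
  \<comment> \<open>At \<open>w = a / n ^ 2\<close> the bound \<open>K / norm w ^ N\<close> is a
    multiple of \<open>n ^ (2 * N)\<close>; \<open>D\<close> dominates its coefficient, and the
    \<open>+ 1\<close> keeps it positive.\<close>
  define D where "D = \<bar>K\<bar> / norm a ^ N + 1"
  have D: "D > 0" by (simp add: D_def add_nonneg_pos)
  have "((\<lambda>n. real n ^ (2 * N) / exp (real n)) \<longlongrightarrow> 0) sequentially"
    using filterlim_compose[OF tendsto_power_div_exp_0 filterlim_real_sequentially] .
  then have "\<forall>\<^sub>F n in sequentially. real n ^ (2 * N) / exp (real n) < 1 / (4 * D)"
    by (rule order_tendstoD) (use D in simp)
  moreover have "(\<lambda>n. norm a / real n ^ 2) \<longlonglongrightarrow> 0"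
    by (intro tendsto_divide_0[OF tendsto_const] filterlim_at_top_imp_at_infinity
        filterlim_pow_at_top filterlim_real_sequentially) simp
  then have "\<forall>\<^sub>F n in sequentially. norm a / real n ^ 2 < r"
    by (rule order_tendstoD) (rule r)
  ultimately have "\<forall>\<^sub>F n in sequentially. False"
    using eventually_ge_at_top[of n0] eventually_gt_at_top[of 0]
  proof eventually_elim
    case (elim n)
    let ?w = "a / of_nat n ^ 2"
    have nw: "norm ?w = norm a / real n ^ 2" by (simp add: norm_divide norm_power)
    have "exp (real n) / 4 \<le> K / norm ?w ^ N"
    proof -
      have "norm (hill_discriminant \<tau> p k ?w) \<le> K / norm ?w ^ N"
        by (rule r(2)) (use nw elim a(1) in auto)
      then show ?thesis using a(2)[OF elim(3)] by linarith
    qed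
    also have "\<dots> = K / norm a ^ N * real n ^ (2 * N)"
      by (simp add: nw power_divide power_mult)
    also have "\<dots> \<le> D * real n ^ (2 * N)"
      by (intro mult_right_mono) (auto simp: D_def divide_right_mono add_increasing2)
    finally have "1 / (4 * D) \<le> real n ^ (2 * N) / exp (real n)"
      using D by (simp add: field_simps)
    with elim(1) show False by simp
  qed
  then show False by simp
qed

end

text \<open>Its contrapositive supplies \<open>two_p\<close>. Reducing the coordinates of
  \<open>2 * p\<close> modulo two and halving yields one of the four representatives.\<close>

lemma two_torsion_of_double:
  assumes "2 * p \<in> lattice \<tau>"
  shows "torus_class \<tau> p \<in> torus_two_torsion \<tau>"
proof -
  obtain m n :: int where mn: "2 * p = of_int m + of_int n * \<tau>"
    using assms by (auto simp: lattice_def)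
  define h where "h = (of_int (m mod 2) + of_int (n mod 2) * \<tau>) / 2"
  have "h \<in> {0, 1/2, \<tau>/2, (1 + \<tau>)/2}"
    using pos_mod_bound[of 2 m] pos_mod_sign[of 2 m] pos_mod_bound[of 2 n] pos_mod_sign[of 2 n]
    unfolding h_def by (cases "m mod 2 = 0"; cases "n mod 2 = 0") (auto simp: not_mod_2_eq_0_eq_1)
  moreover have "torus_class \<tau> p = torus_class \<tau> h"
  proof -
    have div2: "of_int i = (2 * of_int (i div 2) + of_int (i mod 2) :: complex)" for i
      by (metis mult_div_mod_eq of_int_add of_int_mult of_int_numeral)
    have "2 * (p - h) = 2 * (of_int (m div 2) + of_int (n div 2) * \<tau>)"
      unfolding right_diff_distrib mn h_def div2[of m] div2[of n] by (simp add: algebra_simps)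
    then have "p - h = of_int (m div 2) + of_int (n div 2) * \<tau>"
      by (rule mult_left_cancel[THEN iffD1, rotated]) simp
    then have ph: "p - h \<in> lattice \<tau>" unfolding lattice_def by blast
    have "p - w \<in> lattice \<tau> \<longleftrightarrow> h - w \<in> lattice \<tau>" for w
      using lattice_add_iff[OF ph, of "h - w"] by simp
    then show ?thesis by (auto simp: torus_class_def torus_rel_def)
  qed
  ultimately show ?thesis unfolding torus_two_torsion_def by blast
qed

theorem theorem4p1:
  fixes \<tau> p :: complex and k :: nat
  assumes "Im \<tau> > 0"
    and "torus_class \<tau> p \<notin> torus_two_torsion \<tau>"
    and "deriv (weierstrass_wp \<tau>) (2 * p) \<noteq> 0"
    and "k \<in> {1, 2}"
  shows "hill_discriminant \<tau> p k holomorphic_on (- {0}) \<and>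
         isolated_singularity_at (hill_discriminant \<tau> p k) 0 \<and>
         \<not> not_essential (hill_discriminant \<tau> p k) 0"
proof -
  interpret lame \<tau> p
    by unfold_locales (use assms(1,2) two_torsion_of_double in auto)
  show ?thesis
    using hill_discriminant_holomorphic hill_discriminant_isolated
      hill_discriminant_essential[OF assms(3)] by blast
qed

end
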